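(* Let $d_1,d_2,\dots,d_r$ be pairwise relatively prime positive square-free integers with $d_j\ge 2$ for all $1\le j\le r$, and let $N_1,\dots,N_r\ge 2$ be integers. Let $M$ be an irreducible $\mathbb{Z}_+$-module of $R=\mathbb{Z}[d_1^{1/N_1},d_2^{1/N_2},\dots,d_r^{1/N_r}]$. Then: 1. $\mathrm{rank}(M)=N_1N_2\cdots N_r$. 2. For any $1\le j\le r$, put $\widehat{N_j}:=\frac{N_1N_2\cdots N_r}{N_j}$. Then $M\cong\bigoplus_{i=1}^{\widehat{N_j}}M_i$ as a $\mathbb{Z}_+$-module of $\mathbb{Z}[d_j^{1/N_j}]$. Moreover, there exist positive divisors $c_{1j},c_{2j},\dots,c_{N_jj}$ of $d_j$ with $c_{1j}c_{2j}\cdots c_{N_jj}=d_j$ such that for all $1\le i\le\widehat{N_j}$, $$M_i\cong\mathbb{Z}\Big\langle c_{(N_j-1)j}^{\frac{1}{N_j}}\cdots c_{2j}^{\frac{N_j-2}{N_j}}c_{1j}^{\frac{N_j-1}{N_j}},\ c_{N_jj}^{\frac{1}{N_j}}\cdots c_{3j}^{\frac{N_j-2}{N_j}}c_{2j}^{\frac{N_j-1}{N_j}},\ \dots,\ c_{(N_j-2)j}^{\frac{1}{N_j}}\cdots c_{1j}^{\frac{N_j-2}{N_j}}c_{N_jj}^{\frac{N_j-1}{N_j}}\Big\rangle$$ as $\mathbb{Z}_+$-modules of $\mathbb{Z}[d_j^{1/N_j}]$.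
   Context: $\mathbb{Z}_+$ denotes the set of non-negative integers. A unital $\mathbb{Z}_+$-ring is a unital domain $R$, free as a $\mathbb{Z}$-module with a fixed basis $\{x_1=1,x_2,\dots,x_n\}$ such that $x_ix_j=\sum_k c_{ij}^k x_k$ with all $c_{ij}^k\in\mathbb{Z}_+$. A $\mathbb{Z}_+$-module of $R$ is an $R$-module $M$ that is free over $\mathbb{Z}$ with a fixed finite nonempty basis $\{m_1,\dots,m_t\}$ (its $\mathbb{Z}_+$-basis; $t$ is the rank) such that $x_im_j=\sum_k a_{ij}^k m_k$ with all $a_{ij}^k\in\mathbb{Z}_+$. A $\mathbb{Z}_+$-submodule of $M$ is an $R$-submodule that is the $\mathbb{Z}$-span of a subset of $\{m_1,\dots,m_t\}$. $M$ is irreducible if it has no $\mathbb{Z}_+$-submodule other than $0$ and $M$. Two $\mathbb{Z}_+$-modules $M,M'$ of $R$ with bases $\{m_i\}_{i=1}^t$, $\{m'_i\}_{i=1}^t$ are isomorphic if there are an $R$-module homomorphism $\psi:M\to M'$ and a permutation $\sigma\in S_t$ with $\psi(m_i)=m'_{\sigma(i)}$ for all $i$. A direct sum of $\mathbb{Z}_+$-modules has as $\mathbb{Z}_+$-basis the disjoint union of the bases of the summands. All roots $d_j^{1/N_j}$ are positive real roots. $R=\mathbb{Z}[d_1^{1/N_1},\dots,d_r^{1/N_r}]\subset\mathbb{R}$ is a $\mathbb{Z}_+$-ring with $\mathbb{Z}_+$-basis the products $d_1^{i_1/N_1}d_2^{i_2/N_2}\cdots d_r^{i_r/N_r}$, $0\le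 i_s\le N_s-1$. Likewise $\mathbb{Z}[d_j^{1/N_j}]$ has $\mathbb{Z}_+$-basis $1,d_j^{1/N_j},\dots,d_j^{(N_j-1)/N_j}$. A $\mathbb{Z}_+$-module of $R$ is regarded as a $\mathbb{Z}_+$-module of $\mathbb{Z}[d_j^{1/N_j}]$ by restriction, with the same basis. In the displayed module, write $N=N_j$, $d=d_j$, $c_i=c_{ij}$. Its generators are the $N$ real numbers $\prod_{i=0}^{N-1}c_{k+i}^{(N-1-i)/N}$, $1\le k\le N$, with indices of $c$ read modulo $N$ in $\{1,\dots,N\}$. Equivalently, with $v=\prod_{i=1}^{N-1}c_{N-i}^{i/N}$, they are $v,\frac{1}{c_1}d^{1/N}v,\frac{1}{c_1c_2}d^{2/N}v,\dots,\frac{1}{c_1\cdots c_{N-1}}d^{(N-1)/N}v$. The module is the free $\mathbb{Z}$-module on these real numbers, with these as $\mathbb{Z}_+$-basis, and $\mathbb{Z}[d^{1/N}]$ acts by multiplication of real numbers. *)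

theory Defs
  imports
    "HOL-Analysis.Analysis"
    "HOL-Algebra.Algebra"
    "HOL-Algebra.Algebraic_Closure_Type"
    "HOL-Computational_Algebra.Squarefree"
begin

section \<open>Free abelian groups with a fixed finite basis\<close>

definition int_span :: "('b, 'c) ring_scheme \<Rightarrow> 'b set \<Rightarrow> 'b set" where
  "int_span M B = {x. \<exists>c :: 'b \<Rightarrow> int. x = (\<Oplus>\<^bsub>M\<^esub>b\<in>B. add_pow M (c b) b)}"

text \<open>Only the additive group of \<open>M\<close> matters. Coefficient functions are extensional on \<open>B\<close>,
  so that \<open>\<exists>!\<close> says that the coefficients are unique.\<close>

definition int_basis :: "('b, 'c) ring_scheme \<Rightarrow> 'b set \<Rightarrow> bool" where
  "int_basis M B \<longleftrightarrow> finite B \<and> B \<subseteq> carrier M \<and>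
     (\<forall>x\<in>carrier M. \<exists>!c. c \<in> B \<rightarrow>\<^sub>E (UNIV :: int set) \<and> x = (\<Oplus>\<^bsub>M\<^esub>b\<in>B. add_pow M (c b) b))"

section \<open>Modules with non-negative structure constants\<close>

text \<open>
  \<open>E\<close> is the distinguished basis of the scalar ring \<open>R\<close> and \<open>B\<close> that of \<open>M\<close>. The locale does not
  assume that \<open>E\<close> is a \<open>\<int>\<close>-basis of \<open>R\<close> with non-negative structure constants: for the rings
  \<open>radical_ring\<close> below this is a theorem about the linear independence of radicals, and it is not
  to become a hypothesis of statements about \<open>M\<close>. Restricting the scalars to a subring leaves the
  record \<open>M\<close> and the basis \<open>B\<close> unchanged; only \<open>R\<close> and \<open>E\<close> are replaced.
\<close>

locale zplus_module = Module.module R M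
  for R :: "('a, 'c) ring_scheme" and E :: "'a set"
    and M :: "('a, 'b, 'd) module_scheme" and B :: "'b set" +
  assumes basis: "int_basis M B"
    and basis_nonempty: "B \<noteq> {}"
    and nonneg: "\<And>x m. x \<in> E \<Longrightarrow> m \<in> B \<Longrightarrow>
      \<exists>a :: 'b \<Rightarrow> nat. x \<odot>\<^bsub>M\<^esub> m = (\<Oplus>\<^bsub>M\<^esub>b\<in>B. add_pow M (a b) b)"

definition zplus_submodule ::
    "('a, 'c) ring_scheme \<Rightarrow> ('a, 'b, 'd) module_scheme \<Rightarrow> 'b set \<Rightarrow> 'b set \<Rightarrow> bool" where
  "zplus_submodule R M B H \<longleftrightarrow> submodule H R M \<and> (\<exists>S\<subseteq>B. H = int_span M S)"

definition irreducible_zplus_module ::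
    "('a, 'c) ring_scheme \<Rightarrow> 'a set \<Rightarrow> ('a, 'b, 'd) module_scheme \<Rightarrow> 'b set \<Rightarrow> bool" where
  "irreducible_zplus_module R E M B \<longleftrightarrow> zplus_module R E M B \<and>
     (\<forall>H. zplus_submodule R M B H \<longrightarrow> H = {\<zero>\<^bsub>M\<^esub>} \<or> H = carrier M)"

definition linear_maps :: "('a, 'c) ring_scheme \<Rightarrow> ('a, 'b, 'd) module_scheme \<Rightarrow>
    ('a, 'e, 'f) module_scheme \<Rightarrow> ('b \<Rightarrow> 'e) set" where
  "linear_maps R M M' = {h \<in> carrier M \<rightarrow> carrier M'.
     (\<forall>x\<in>carrier M. \<forall>y\<in>carrier M. h (x \<oplus>\<^bsub>M\<^esub> y) = h x \<oplus>\<^bsub>M'\<^esub> h y) \<and>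
     (\<forall>a\<in>carrier R. \<forall>x\<in>carrier M. h (a \<odot>\<^bsub>M\<^esub> x) = a \<odot>\<^bsub>M'\<^esub> h x)}"

definition zplus_isomorphic :: "('a, 'c) ring_scheme \<Rightarrow> 'a set \<Rightarrow>
    ('a, 'b, 'd) module_scheme \<Rightarrow> 'b set \<Rightarrow> ('a, 'e, 'f) module_scheme \<Rightarrow> 'e set \<Rightarrow> bool" where
  "zplus_isomorphic R E M B M' B' \<longleftrightarrow>
     zplus_module R E M B \<and> zplus_module R E M' B' \<and>
     (\<exists>\<psi>\<in>linear_maps R M M'. bij_betw \<psi> B B')"

text \<open>
  External direct sum, meant for finite \<open>I\<close> only. The fields \<open>mult\<close> and \<open>one\<close> are present because
  module records extend ring records; they play no role.
\<close>

definition direct_sum :: "'i set \<Rightarrow> ('i \<Rightarrow> ('a, 'b, 'd) module_scheme) \<Rightarrow> ('a, 'i \<Rightarrow> 'b) module" where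
  "direct_sum I M = \<lparr>
     carrier = (\<Pi>\<^sub>E i\<in>I. carrier (M i)),
     monoid.mult = (\<lambda>x y. \<lambda>i\<in>I. x i \<otimes>\<^bsub>M i\<^esub> y i),
     one = (\<lambda>i\<in>I. \<one>\<^bsub>M i\<^esub>),
     ring.zero = (\<lambda>i\<in>I. \<zero>\<^bsub>M i\<^esub>),
     add = (\<lambda>x y. \<lambda>i\<in>I. x i \<oplus>\<^bsub>M i\<^esub> y i),
     smult = (\<lambda>a x. \<lambda>i\<in>I. a \<odot>\<^bsub>M i\<^esub> x i)\<rparr>"

definition direct_sum_basis ::
    "'i set \<Rightarrow> ('i \<Rightarrow> ('a, 'b, 'd) module_scheme) \<Rightarrow> ('i \<Rightarrow> 'b set) \<Rightarrow> ('i \<Rightarrow> 'b) set" where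
  "direct_sum_basis I M B =
     (\<Union>i\<in>I. (\<lambda>b. \<lambda>k\<in>I. if k = i then b else \<zero>\<^bsub>M k\<^esub>) ` B i)"

section \<open>Rings generated by real radicals\<close>

text \<open>
  The subring of the reals generated by the positive real roots \<open>d\<^sub>j\<^bsup>1/N\<^sub>j\<^esup>\<close>, \<open>j \<in> J\<close>, together
  with its distinguished basis. The set \<open>J = {1..r}\<close> gives the ring in all \<open>r\<close> radicals and
  \<open>J = {j}\<close> the ring in a single one.
\<close>

definition radical_ring :: "nat set \<Rightarrow> (nat \<Rightarrow> nat) \<Rightarrow> (nat \<Rightarrow> nat) \<Rightarrow> real ring" where
  "radical_ring J d N = ring_of_type_algebra
     \<lparr>carrier := generate_ring ring_of_type_algebra ((\<lambda>j. real (d j) powr (1 / real (N j))) ` J)\<rparr>"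

definition radical_basis :: "nat set \<Rightarrow> (nat \<Rightarrow> nat) \<Rightarrow> (nat \<Rightarrow> nat) \<Rightarrow> real set" where
  "radical_basis J d N =
     {\<Prod>j\<in>J. real (d j) powr (real (i j) / real (N j)) | i. \<forall>j\<in>J. i j < N j}"

section \<open>The modules attached to a cyclic factorisation\<close>

definition real_module :: "(real, real) module" where
  "real_module = \<lparr>carrier = UNIV, monoid.mult = (*), one = 1, ring.zero = 0, add = (+), smult = (*)\<rparr>"

definition real_lattice :: "real set \<Rightarrow> (real, real) module" where
  "real_lattice G = real_module\<lparr>carrier := int_span real_module G\<rparr>"

text \<open>The index \<open>(k + i - 1) mod n + 1\<close> is the representative of \<open>k + i\<close> modulo \<open>n\<close> in \<open>{1..n}\<close>.\<close>

definition cyclic_generator :: "nat \<Rightarrow> (nat \<Rightarrow> nat) \<Rightarrow> nat \<Rightarrow> real" where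
  "cyclic_generator n c k =
     (\<Prod>i = 0..n - 1. real (c ((k + i - 1) mod n + 1)) powr (real (n - 1 - i) / real n))"

definition cyclic_basis :: "nat \<Rightarrow> (nat \<Rightarrow> nat) \<Rightarrow> real set" where
  "cyclic_basis n c = cyclic_generator n c ` {1..n}"

definition cyclic_module :: "nat \<Rightarrow> (nat \<Rightarrow> nat) \<Rightarrow> (real, real) module" where
  "cyclic_module n c = real_lattice (cyclic_basis n c)"

end

theory Submission
  imports Defs "HOL-Number_Theory.Cong"
begin

text \<open>
  Write \<open>\<alpha>\<^sub>j\<close> for the positive root \<open>d\<^sub>j\<^bsup>1/N\<^sub>j\<^esup>\<close>. On the basis \<open>B\<close> both \<open>\<alpha>\<^sub>j\<close> and its power with
  exponent \<open>N\<^sub>j - 1\<close> act by non-negative integer matrices, and the product of these two matrices, in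
  either order, is \<open>d\<^sub>j\<close> times the identity. A non-negative matrix with a non-negative inverse up to
  a scalar is monomial (\<open>nonneg_inverse_pair_monomial\<close>), hence \<open>\<alpha>\<^sub>j b = a\<^sub>j(b) s\<^sub>j(b)\<close> with
  \<open>s\<^sub>j(b) \<in> B\<close> and \<open>a\<^sub>j(b) > 0\<close>. Comparing coefficients in \<open>\<alpha>\<^sub>i \<alpha>\<^sub>j = \<alpha>\<^sub>j \<alpha>\<^sub>i\<close> and in the equation that
  defines \<open>\<alpha>\<^sub>j\<close> shows that the \<open>s\<^sub>j\<close> commute and have period \<open>N\<^sub>j\<close>, that the weights
  \<open>a\<^sub>j\<close> met in \<open>N\<^sub>j\<close> consecutive steps along \<open>s\<^sub>j\<close> multiply to \<open>d\<^sub>j\<close>, and, because the \<open>d\<^sub>j\<close> are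
  coprime, that \<open>a\<^sub>j\<close> is invariant under \<open>s\<^sub>i\<close> for \<open>i \<noteq> j\<close>. Irreducibility says that no proper
  nonempty subset of \<open>B\<close> is closed under all \<open>s\<^sub>j\<close> (\<open>ex_weighted_permutations\<close>).

  The rest of the rank formula is combinatorics. Let \<open>l\<close> be a prime divisor of \<open>d\<^sub>j\<close>. Since \<open>d\<^sub>j\<close> is
  square-free, exactly one weight per period of \<open>s\<^sub>j\<close> is divisible by \<open>l\<close>, and by invariance the
  position of this weight is moved by \<open>s\<^sub>j\<close> only. These positions distinguish the elements obtained
  from one basis element by \<open>e\<^sub>1\<close> steps along \<open>s\<^sub>1\<close>, \<open>e\<^sub>2\<close> steps along \<open>s\<^sub>2\<close> and so on with
  \<open>e\<^sub>j < N\<^sub>j\<close>, and by transitivity they exhaust \<open>B\<close> (\<open>card_eq_prod\<close>).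
  For the same reason all orbits of \<open>s\<^sub>j\<close> have \<open>N\<^sub>j\<close> elements, and all carry the same cyclic sequence
  of weights; this sequence is \<open>c\<^sub>1, c\<^sub>2, \<dots>\<close> (\<open>orbit_decomposition\<close>).

  As a module of the ring in the single radical \<open>\<alpha>\<^sub>j\<close>, \<open>M\<close> is the direct sum of the spans of the
  orbits of \<open>s\<^sub>j\<close> (\<open>direct_sum_decomposition\<close>). The generators \<open>g\<^sub>k\<close> of the cyclic module satisfy
  \<open>\<alpha>\<^sub>j g\<^sub>k = c\<^sub>k g\<^bsub>k+1\<^esub>\<close>, the relation that holds along an orbit, so mapping the orbit to the \<open>g\<^sub>k\<close>
  gives a linear map \<open>h\<close> from the span of the orbit onto the lattice spanned by the \<open>g\<^sub>k\<close>. It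
  remains to see that \<open>h\<close> is injective, that is, that the \<open>g\<^sub>k\<close> are linearly independent over the
  integers (\<open>zplus_module_cyclic_iso\<close>). For \<open>z\<close> in the span of the orbit of \<open>x\<close>, \<open>d\<^sub>j z = u x\<close> for
  some ring element \<open>u\<close>. If \<open>h z = 0\<close> then the real number \<open>u h(x)\<close> vanishes, so \<open>u = 0\<close>
  and \<open>z = 0\<close>. Thus the independence of the radicals is read off from the module \<open>M\<close> itself.
\<close>

section \<open>Coordinates in a based abelian group\<close>

definition lin_comb :: "('b, 'c) ring_scheme \<Rightarrow> 'b set \<Rightarrow> ('b \<Rightarrow> int) \<Rightarrow> 'b" where
  "lin_comb G B c = (\<Oplus>\<^bsub>G\<^esub>b\<in>B. add_pow G (c b) b)"

context abelian_group
begin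

lemma int_mult_closed [simp]: "x \<in> carrier G \<Longrightarrow> add_pow G (k::int) x \<in> carrier G"
  using group.int_pow_closed[OF a_group, of x k] by (simp add: add_pow_def)

lemma int_mult_add:
  "x \<in> carrier G \<Longrightarrow> add_pow G (k + l :: int) x = add_pow G k x \<oplus> add_pow G l x"
  using group.int_pow_mult[OF a_group, of x k l] by (simp add: add_pow_def)

lemma int_mult_assoc:
  "x \<in> carrier G \<Longrightarrow> add_pow G (k :: int) (add_pow G (l :: int) x) = add_pow G (k * l) x"
  using group.int_pow_pow[OF a_group, of x l k] by (simp add: add_pow_def mult.commute)

lemma int_mult_minus:
  "x \<in> carrier G \<Longrightarrow> add_pow G (- k :: int) x = \<ominus> add_pow G k x"
  using group.int_pow_neg[OF a_group, of x k] by (simp add: add_pow_def a_inv_def)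

lemma int_mult_zero [simp]: "add_pow G (0 :: int) x = \<zero>"
  by (simp add: add_pow_def)

lemma int_mult_one [simp]: "x \<in> carrier G \<Longrightarrow> add_pow G (1 :: int) x = x"
  using group.int_pow_1[OF a_group, of x] by (simp add: add_pow_def)

lemma int_mult_distrib:
  "x \<in> carrier G \<Longrightarrow> y \<in> carrier G \<Longrightarrow>
   add_pow G (k :: int) (x \<oplus> y) = add_pow G k x \<oplus> add_pow G k y"
  using comm_group.int_pow_distrib[OF a_comm_group, of x y k] by (simp add: add_pow_def)

lemma int_mult_of_zero [simp]: "add_pow G (k :: int) \<zero> = \<zero>"
  using group.int_pow_one[OF a_group, of k] by (simp add: add_pow_def)

lemma lin_comb_closed [simp]: "B \<subseteq> carrier G \<Longrightarrow> lin_comb G B c \<in> carrier G"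
  unfolding lin_comb_def by (rule finsum_closed) auto

lemma lin_comb_add:
  assumes "B \<subseteq> carrier G"
  shows "lin_comb G B (\<lambda>b. c b + c' b) = lin_comb G B c \<oplus> lin_comb G B c'"
proof -
  have "lin_comb G B (\<lambda>b. c b + c' b) = (\<Oplus>b\<in>B. add_pow G (c b) b \<oplus> add_pow G (c' b) b)"
    unfolding lin_comb_def using assms by (intro finsum_cong') (auto simp: int_mult_add)
  also have "\<dots> = lin_comb G B c \<oplus> lin_comb G B c'"
    unfolding lin_comb_def using assms by (intro finsum_addf) auto
  finally show ?thesis .
qed

lemma lin_comb_mult:
  assumes "finite B" "B \<subseteq> carrier G"
  shows "lin_comb G B (\<lambda>b. k * c b) = add_pow G k (lin_comb G B c)"
  using assms unfolding lin_comb_def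
proof (induction B rule: finite_induct)
  case (insert x F)
  have F: "(\<lambda>b. add_pow G (k * c b) b) \<in> F \<rightarrow> carrier G" "(\<lambda>b. add_pow G (c b) b) \<in> F \<rightarrow> carrier G"
    using insert.prems by auto
  show ?case
    using insert F by (simp add: int_mult_distrib int_mult_assoc)
qed simp

lemma lin_comb_cong:
  assumes "B \<subseteq> carrier G" "\<And>b. b \<in> B \<Longrightarrow> c b = c' b"
  shows "lin_comb G B c = lin_comb G B c'"
  unfolding lin_comb_def using assms by (intro finsum_cong') auto

lemma lin_comb_subset:
  assumes "finite B" "B \<subseteq> carrier G" "T \<subseteq> B"
  shows "lin_comb G T c = lin_comb G B (\<lambda>b. if b \<in> T then c b else 0)"
  unfolding lin_comb_def using assms
  by (intro add.finprod_mono_neutral_cong_left) auto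

lemma lin_comb_single:
  assumes "finite B" "B \<subseteq> carrier G" "b \<in> B"
  shows "lin_comb G B (\<lambda>x. if x = b then k else 0) = add_pow G k b"
proof -
  have "lin_comb G B (\<lambda>x. if x = b then k else 0) = lin_comb G B (\<lambda>x. if x \<in> {b} then k else 0)"
    by (rule lin_comb_cong) (use assms in auto)
  also have "\<dots> = lin_comb G {b} (\<lambda>_. k)"
    using lin_comb_subset[of B "{b}" "\<lambda>_. k"] assms by simp
  also have "\<dots> = add_pow G k b"
    using assms unfolding lin_comb_def by (subst finsum_insert) auto
  finally show ?thesis .
qed

lemma lin_comb_zero [simp]: "lin_comb G B (\<lambda>_. 0) = \<zero>"
  by (simp add: lin_comb_def)

end

definition additive_map :: "('a, 'c) ring_scheme \<Rightarrow> ('b, 'd) ring_scheme \<Rightarrow> ('a \<Rightarrow> 'b) \<Rightarrow> bool" where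
  "additive_map G H h \<longleftrightarrow> h \<in> carrier G \<rightarrow> carrier H \<and>
     (\<forall>x\<in>carrier G. \<forall>y\<in>carrier G. h (x \<oplus>\<^bsub>G\<^esub> y) = h x \<oplus>\<^bsub>H\<^esub> h y)"

lemma additive_map_group_hom:
  assumes "abelian_group G" "abelian_group H" "additive_map G H h"
  shows "group_hom (add_monoid G) (add_monoid H) h"
  using assms by (auto simp: group_hom_def group_hom_axioms_def abelian_group.a_group hom_def
      additive_map_def)

lemma additive_map_zero:
  assumes "abelian_group G" "abelian_group H" "additive_map G H h"
  shows "h \<zero>\<^bsub>G\<^esub> = \<zero>\<^bsub>H\<^esub>"
  using group_hom.hom_one[OF additive_map_group_hom[OF assms]] by simp

lemma additive_map_minus:
  assumes "abelian_group G" "abelian_group H" "additive_map G H h" "x \<in> carrier G"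
  shows "h (\<ominus>\<^bsub>G\<^esub> x) = \<ominus>\<^bsub>H\<^esub> h x"
  using group_hom.hom_inv[OF additive_map_group_hom[OF assms(1-3)], of x] assms(4)
  by (simp add: a_inv_def)

lemma additive_map_mult:
  assumes "abelian_group G" "abelian_group H" "additive_map G H h" "x \<in> carrier G"
  shows "h (add_pow G (k::int) x) = add_pow H k (h x)"
  using group_hom.hom_int_pow[OF additive_map_group_hom[OF assms(1-3)], of x k] assms(4)
  by (simp add: add_pow_def)

lemma additive_map_lin_comb:
  assumes G: "abelian_group G" and H: "abelian_group H" and h: "additive_map G H h"
    and A: "finite A" "A \<subseteq> carrier G"
  shows "h (lin_comb G A c) = (\<Oplus>\<^bsub>H\<^esub>b\<in>A. add_pow H (c b) (h b))"
  using A
proof (induction A rule: finite_induct)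
  case empty
  interpret G: abelian_group G by (rule G)
  interpret H: abelian_group H by (rule H)
  show ?case
    using additive_map_zero[OF G H h] by (simp add: lin_comb_def)
next
  case (insert x F)
  interpret G: abelian_group G by (rule G)
  interpret H: abelian_group H by (rule H)
  have hc: "h y \<in> carrier H" if "y \<in> carrier G" for y
    using h that by (auto simp: additive_map_def)
  have ins: "lin_comb G (insert x F) c = add_pow G (c x) x \<oplus>\<^bsub>G\<^esub> lin_comb G F c"
    unfolding lin_comb_def using insert by (subst G.finsum_insert) auto
  have "h (lin_comb G (insert x F) c) = h (add_pow G (c x) x) \<oplus>\<^bsub>H\<^esub> h (lin_comb G F c)"
    using h insert.prems unfolding ins additive_map_def by simp
  also have "\<dots> = add_pow H (c x) (h x) \<oplus>\<^bsub>H\<^esub> (\<Oplus>\<^bsub>H\<^esub>b\<in>F. add_pow H (c b) (h b))"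
    using insert additive_map_mult[OF G H h, of x "c x"] by simp
  also have "\<dots> = (\<Oplus>\<^bsub>H\<^esub>b\<in>insert x F. add_pow H (c b) (h b))"
    using insert hc by (subst H.finsum_insert) auto
  finally show ?case .
qed

lemma additive_map_lin_comb_inj:
  assumes G: "abelian_group G" and H: "abelian_group H" and h: "additive_map G H h"
    and A: "finite A" "A \<subseteq> carrier G" "inj_on h A"
  shows "h (lin_comb G A (\<lambda>b. c (h b))) = lin_comb H (h ` A) c"
proof -
  interpret H: abelian_group H by (rule H)
  have hc: "h y \<in> carrier H" if "y \<in> carrier G" for y
    using h that by (auto simp: additive_map_def)
  have "(\<lambda>b. add_pow H (c b) b) \<in> h ` A \<rightarrow> carrier H"
    using hc A by auto
  from H.finsum_reindex[OF this A(3)] show ?thesis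
    using additive_map_lin_comb[OF G H h A(1,2)] by (simp add: lin_comb_def)
qed

lemma int_basis_iff_lin_comb:
  "int_basis G B \<longleftrightarrow> finite B \<and> B \<subseteq> carrier G \<and>
     (\<forall>x\<in>carrier G. \<exists>!c. c \<in> B \<rightarrow>\<^sub>E (UNIV :: int set) \<and> x = lin_comb G B c)"
  by (simp add: int_basis_def lin_comb_def)

lemma int_span_iff_lin_comb: "x \<in> int_span G B \<longleftrightarrow> (\<exists>c. x = lin_comb G B c)"
  by (simp add: int_span_def lin_comb_def)

definition coord :: "('b, 'c) ring_scheme \<Rightarrow> 'b set \<Rightarrow> 'b \<Rightarrow> 'b \<Rightarrow> int" where
  "coord G B x = (THE c. c \<in> B \<rightarrow>\<^sub>E (UNIV :: int set) \<and> x = lin_comb G B c)"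

locale based_group = abelian_group G for G (structure) +
  fixes B
  assumes int_basis: "int_basis G B"
begin

lemma finite_B: "finite B" and B_closed: "B \<subseteq> carrier G"
  using int_basis by (auto simp: int_basis_def)

lemma B_in_carrier [simp]: "b \<in> B \<Longrightarrow> b \<in> carrier G"
  using B_closed by blast

lemma lin_comb_coord [simp]: "x \<in> carrier G \<Longrightarrow> lin_comb G B (coord G B x) = x"
  using int_basis theI'[of "\<lambda>c. c \<in> B \<rightarrow>\<^sub>E (UNIV :: int set) \<and> x = lin_comb G B c"]
  unfolding int_basis_iff_lin_comb coord_def by auto

lemma coord_lin_comb [simp]:
  assumes "b \<in> B"
  shows "coord G B (lin_comb G B c) b = c b"
proof -
  have "restrict c B \<in> B \<rightarrow>\<^sub>E (UNIV :: int set)" "lin_comb G B c = lin_comb G B (restrict c B)"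
    using B_closed by (auto intro: lin_comb_cong)
  moreover have "lin_comb G B c \<in> carrier G" using B_closed by simp
  ultimately have "coord G B (lin_comb G B c) = restrict c B"
    using int_basis unfolding int_basis_iff_lin_comb coord_def
    by (intro the1_equality) blast+
  with assms show ?thesis by simp
qed

lemma coord_add:
  assumes "x \<in> carrier G" "y \<in> carrier G" "b \<in> B"
  shows "coord G B (x \<oplus> y) b = coord G B x b + coord G B y b"
proof -
  have "x \<oplus> y = lin_comb G B (\<lambda>b. coord G B x b + coord G B y b)"
    using assms B_closed by (simp add: lin_comb_add)
  with assms(3) show ?thesis by simp
qed

lemma coord_mult:
  assumes "x \<in> carrier G" "b \<in> B"
  shows "coord G B (add_pow G (k::int) x) b = k * coord G B x b"
proof -
  have "add_pow G k x = lin_comb G B (\<lambda>b. k * coord G B x b)"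
    using assms B_closed finite_B by (simp add: lin_comb_mult)
  with assms(2) show ?thesis by simp
qed

lemma coord_zero [simp]: "b \<in> B \<Longrightarrow> coord G B \<zero> b = 0"
  using coord_lin_comb[of b "\<lambda>_. 0"] by simp

lemma coord_minus:
  assumes "x \<in> carrier G" "b \<in> B"
  shows "coord G B (\<ominus> x) b = - coord G B x b"
  using coord_mult[OF assms, of "-1"] int_mult_minus[of x 1] assms by simp

lemma coord_basis: "b \<in> B \<Longrightarrow> b' \<in> B \<Longrightarrow> coord G B b b' = (if b' = b then 1 else 0)"
  using coord_lin_comb[of b' "\<lambda>x. if x = b then 1 else 0"] lin_comb_single[OF finite_B B_closed, of b 1]
  by simp

lemma coord_eqI:
  assumes "x \<in> carrier G" "y \<in> carrier G" "\<And>b. b \<in> B \<Longrightarrow> coord G B x b = coord G B y b"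
  shows "x = y"
proof -
  have "lin_comb G B (coord G B x) = lin_comb G B (coord G B y)"
    by (rule lin_comb_cong) (use assms B_closed in auto)
  with assms show ?thesis by simp
qed

lemma mult_basis_inject:
  assumes "b \<in> B" "b' \<in> B" "k > 0" "add_pow G (k::int) b = add_pow G l b'"
  shows "b = b'" "k = l"
proof -
  have "k * coord G B b b = l * coord G B b' b"
    using assms coord_mult[of b b k] coord_mult[of b' b l] by simp
  then have *: "k = l * (if b = b' then 1 else 0)" using assms by (simp add: coord_basis)
  then show "b = b'" using \<open>k > 0\<close> by (auto split: if_splits)
  with * show "k = l" by simp
qed

lemma torsion_free:
  assumes "x \<in> carrier G" "k \<noteq> 0" "add_pow G (k::int) x = \<zero>"
  shows "x = \<zero>"
proof (rule coord_eqI)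
  fix b assume b: "b \<in> B"
  then have "k * coord G B x b = 0" using assms coord_mult[of x b k] by simp
  with b \<open>k \<noteq> 0\<close> show "coord G B x b = coord G B \<zero> b" by simp
qed (use assms in auto)

text \<open>This turns the closure properties of spans into statements about single coordinates.\<close>

lemma span_iff:
  assumes "T \<subseteq> B"
  shows "x \<in> int_span G T \<longleftrightarrow> x \<in> carrier G \<and> (\<forall>b\<in>B - T. coord G B x b = 0)"
proof safe
  assume "x \<in> int_span G T"
  then obtain c where c: "x = lin_comb G T c" by (auto simp: int_span_iff_lin_comb)
  show "x \<in> carrier G" using c assms B_closed by auto
  fix b assume "b \<in> B" "b \<notin> T"
  then show "coord G B x b = 0"
    using c lin_comb_subset[OF finite_B B_closed assms, of c] by simp
next
  assume x: "x \<in> carrier G" "\<forall>b\<in>B - T. coord G B x b = 0"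
  have "x = lin_comb G B (coord G B x)" using x by simp
  also have "\<dots> = lin_comb G B (\<lambda>b. if b \<in> T then coord G B x b else 0)"
    by (rule lin_comb_cong) (use x B_closed in auto)
  also have "\<dots> = lin_comb G T (coord G B x)"
    using lin_comb_subset[OF finite_B B_closed assms] by simp
  finally show "x \<in> int_span G T" by (auto simp: int_span_iff_lin_comb)
qed

lemma span_B: "int_span G B = carrier G"
  using span_iff[of B] by auto

lemma span_induct:
  assumes "T \<subseteq> carrier G" "finite T" "x \<in> int_span G T"
    and zero: "P \<zero>"
    and add: "\<And>x y. x \<in> carrier G \<Longrightarrow> y \<in> carrier G \<Longrightarrow> P x \<Longrightarrow> P y \<Longrightarrow> P (x \<oplus> y)"
    and basis: "\<And>k b. b \<in> T \<Longrightarrow> P (add_pow G (k::int) b)"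
  shows "P x"
proof -
  obtain c where c: "x = lin_comb G T c" using assms(3) by (auto simp: int_span_iff_lin_comb)
  have "P (lin_comb G T c)" using assms(2,1) basis
  proof (induction T rule: finite_induct)
    case empty
    then show ?case using zero by (simp add: lin_comb_def)
  next
    case (insert x F)
    have ins: "lin_comb G (insert x F) c = add_pow G (c x) x \<oplus> lin_comb G F c"
      unfolding lin_comb_def using insert by (subst finsum_insert) auto
    show ?case unfolding ins using insert by (intro add) auto
  qed
  with c show ?thesis by simp
qed

lemma carrier_induct:
  assumes "x \<in> carrier G" "P \<zero>"
    and "\<And>x y. x \<in> carrier G \<Longrightarrow> y \<in> carrier G \<Longrightarrow> P x \<Longrightarrow> P y \<Longrightarrow> P (x \<oplus> y)"
    and "\<And>k b. b \<in> B \<Longrightarrow> P (add_pow G (k::int) b)"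
  shows "P x"
  using span_induct[of B x P] assms finite_B B_closed span_B by blast

lemma additive_map_eqI:
  assumes H: "abelian_group H" and f: "additive_map G H f" and g: "additive_map G H g"
    and eq: "\<And>b. b \<in> B \<Longrightarrow> f b = g b" and x: "x \<in> carrier G"
  shows "f x = g x"
  using x
proof (rule carrier_induct)
  show "f \<zero> = g \<zero>"
    using additive_map_zero[OF abelian_group_axioms H f]
      additive_map_zero[OF abelian_group_axioms H g] by simp
next
  fix x y assume "x \<in> carrier G" "y \<in> carrier G" "f x = g x" "f y = g y"
  then show "f (x \<oplus> y) = g (x \<oplus> y)" using f g by (simp add: additive_map_def)
next
  fix k :: int and b assume "b \<in> B"
  then show "f (add_pow G k b) = g (add_pow G k b)"
    using additive_map_mult[OF abelian_group_axioms H f, of b k]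
      additive_map_mult[OF abelian_group_axioms H g, of b k] eq by simp
qed

end

context based_group
begin

lemma coord_finsum:
  assumes "finite A" "f \<in> A \<rightarrow> carrier G" "b \<in> B"
  shows "coord G B (\<Oplus>e\<in>A. f e) b = (\<Sum>e\<in>A. coord G B (f e) b)"
  using assms
proof (induction A rule: finite_induct)
  case (insert e A)
  then have "f \<in> A \<rightarrow> carrier G" "f e \<in> carrier G" by auto
  then show ?case using insert by (simp add: coord_add)
qed simp

text \<open>The matrix of an additive map acts on coordinates. For the composition of two scalars this is the
  product of their matrices.\<close>

lemma coord_additive_map:
  assumes h: "additive_map G G h" and x: "x \<in> carrier G" and b: "b \<in> B"
  shows "coord G B (h x) b = (\<Sum>e\<in>B. coord G B x e * coord G B (h e) b)"
proof -
  have hc: "h e \<in> carrier G" if "e \<in> B" for e using h that by (auto simp: additive_map_def)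
  have "h x = (\<Oplus>e\<in>B. add_pow G (coord G B x e) (h e))"
    using additive_map_lin_comb[OF abelian_group_axioms abelian_group_axioms h finite_B B_closed,
        of "coord G B x"] x by simp
  then show ?thesis
    using hc b finite_B by (simp add: coord_finsum Pi_def coord_mult)
qed

text \<open>The projection onto the span of \<open>T\<close> along the span of \<open>B - T\<close>.\<close>

definition proj :: "'a set \<Rightarrow> 'a \<Rightarrow> 'a" where
  "proj T x = lin_comb G B (\<lambda>b. if b \<in> T then coord G B x b else 0)"

lemma proj_closed [simp]: "proj T x \<in> carrier G"
  using B_closed by (simp add: proj_def)

lemma coord_proj [simp]:
  "b \<in> B \<Longrightarrow> coord G B (proj T x) b = (if b \<in> T then coord G B x b else 0)"
  by (simp add: proj_def)

lemma additive_proj: "additive_map G G (proj T)"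
  by (auto simp: additive_map_def coord_add intro!: coord_eqI)

lemma proj_of_span:
  assumes "T \<subseteq> B" "x \<in> int_span G T"
  shows "proj T x = x"
  using assms by (intro coord_eqI) (auto simp: span_iff)

lemma proj_disjoint:
  assumes "T \<subseteq> B" "x \<in> int_span G T" "T \<inter> T' = {}"
  shows "proj T' x = \<zero>"
  using assms by (intro coord_eqI) (auto simp: span_iff)

lemma proj_in_span: "T \<subseteq> B \<Longrightarrow> proj T x \<in> int_span G T"
  by (auto simp: span_iff)

lemma mult_basis_in_span: "T \<subseteq> B \<Longrightarrow> b \<in> T \<Longrightarrow> add_pow G (k :: int) b \<in> int_span G T"
  by (auto simp: span_iff coord_mult coord_basis subset_iff)

lemma basis_in_span: "T \<subseteq> B \<Longrightarrow> b \<in> T \<Longrightarrow> b \<in> int_span G T"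
  using mult_basis_in_span[of T b 1] by (auto simp: subset_iff)

end


section \<open>Modules with non-negative structure constants\<close>

lemma nonneg_lin_comb_iff:
  assumes "abelian_group M" "B \<subseteq> carrier M"
  shows "(\<exists>a :: 'b \<Rightarrow> nat. y = (\<Oplus>\<^bsub>M\<^esub>b\<in>B. add_pow M (a b) b)) \<longleftrightarrow>
    (\<exists>c. (\<forall>b\<in>B. c b \<ge> 0) \<and> y = lin_comb M B c)"
proof -
  interpret M: abelian_group M by fact
  have nat: "add_pow M (n::nat) b = add_pow M (int n) b" for n b
    by (simp add: add_pow_def int_pow_int)
  show ?thesis
  proof safe
    fix a :: "'b \<Rightarrow> nat"
    show "\<exists>c. (\<forall>b\<in>B. 0 \<le> c b) \<and> (\<Oplus>\<^bsub>M\<^esub>b\<in>B. add_pow M (a b) b) = lin_comb M B c"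
      by (intro exI[of _ "\<lambda>b. int (a b)"]) (simp add: lin_comb_def nat)
  next
    fix c :: "'b \<Rightarrow> int" assume c: "\<forall>b\<in>B. 0 \<le> c b"
    have "lin_comb M B c = lin_comb M B (\<lambda>b. int (nat (c b)))"
      by (rule M.lin_comb_cong) (use c assms in auto)
    then show "\<exists>a :: 'b \<Rightarrow> nat. lin_comb M B c = (\<Oplus>\<^bsub>M\<^esub>b\<in>B. add_pow M (a b) b)"
      by (intro exI[of _ "\<lambda>b. nat (c b)"]) (simp add: lin_comb_def nat)
  qed
qed

text \<open>Integer coefficients with a sign condition replace natural coefficients, so that the
  integral coordinates apply to the structure constants.\<close>

lemma zplus_module_iff:
  "zplus_module R E M B \<longleftrightarrow> Module.module R M \<and> int_basis M B \<and> B \<noteq> {} \<and>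
     (\<forall>x\<in>E. \<forall>m\<in>B. \<exists>c. (\<forall>b\<in>B. c b \<ge> 0) \<and> x \<odot>\<^bsub>M\<^esub> m = lin_comb M B c)"
proof -
  have "(\<forall>x\<in>E. \<forall>m\<in>B. \<exists>a :: 'c \<Rightarrow> nat. x \<odot>\<^bsub>M\<^esub> m = (\<Oplus>\<^bsub>M\<^esub>b\<in>B. add_pow M (a b) b)) \<longleftrightarrow>
     (\<forall>x\<in>E. \<forall>m\<in>B. \<exists>c. (\<forall>b\<in>B. c b \<ge> 0) \<and> x \<odot>\<^bsub>M\<^esub> m = lin_comb M B c)"
    if "Module.module R M" "int_basis M B"
  proof -
    have "abelian_group M" using that(1) by (simp add: Module.module_def)
    moreover have "B \<subseteq> carrier M" using that(2) by (simp add: int_basis_def)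
    ultimately show ?thesis by (intro ball_cong refl nonneg_lin_comb_iff)
  qed
  moreover have "zplus_module R E M B \<longleftrightarrow> Module.module R M \<and> int_basis M B \<and> B \<noteq> {} \<and>
     (\<forall>x\<in>E. \<forall>m\<in>B. \<exists>a :: 'c \<Rightarrow> nat. x \<odot>\<^bsub>M\<^esub> m = (\<Oplus>\<^bsub>M\<^esub>b\<in>B. add_pow M (a b) b))"
    unfolding zplus_module_def zplus_module_axioms_def by blast
  ultimately show ?thesis by (simp cong: conj_cong)
qed

lemma (in zplus_module) based_group: "based_group M B"
  using basis by (simp add: based_group_def based_group_axioms_def abelian_group_axioms)

lemma linear_maps_additive: "h \<in> linear_maps R M M' \<Longrightarrow> additive_map M M' h"
  by (auto simp: linear_maps_def additive_map_def)

lemma linear_maps_smult: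
  "h \<in> linear_maps R M M' \<Longrightarrow> x \<in> carrier R \<Longrightarrow> m \<in> carrier M \<Longrightarrow>
   h (x \<odot>\<^bsub>M\<^esub> m) = x \<odot>\<^bsub>M'\<^esub> h m"
  by (auto simp: linear_maps_def)

text \<open>The target is only a record at first: its module axioms are inherited along \<open>h\<close>. The zero of the
  target is an independent field of the record and needs a hypothesis of its own.\<close>

lemma linear_bij_module:
  assumes M: "Module.module R M"
    and h: "h \<in> linear_maps R M M'" and bij: "bij_betw h (carrier M) (carrier M')"
    and zero: "h \<zero>\<^bsub>M\<^esub> = \<zero>\<^bsub>M'\<^esub>"
  shows "Module.module R M'"
proof -
  interpret M: Module.module R M by (rule M)
  have img: "carrier M' = h ` carrier M" using bij by (simp add: bij_betw_def)
  have add: "h x \<oplus>\<^bsub>M'\<^esub> h y = h (x \<oplus>\<^bsub>M\<^esub> y)" if "x \<in> carrier M" "y \<in> carrier M" for x y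
    using h that by (simp add: linear_maps_def)
  have smult: "a \<odot>\<^bsub>M'\<^esub> h x = h (a \<odot>\<^bsub>M\<^esub> x)" if "a \<in> carrier R" "x \<in> carrier M" for a x
    using h that by (simp add: linear_maps_def)
  show ?thesis
  proof (rule Module.moduleI)
    show "cring R" by (rule M.R.is_cring)
    show "abelian_group M'"
    proof (rule abelian_groupI)
      fix x assume "x \<in> carrier M'"
      then obtain u where "u \<in> carrier M" "x = h u" using img by auto
      then show "\<exists>y\<in>carrier M'. y \<oplus>\<^bsub>M'\<^esub> x = \<zero>\<^bsub>M'\<^esub>"
        using img by (intro bexI[of _ "h (\<ominus>\<^bsub>M\<^esub> u)"]) (auto simp: add zero M.M.l_neg)
    qed (auto simp: img add zero[symmetric] M.M.a_ac)
  qed (auto simp: img add smult M.smult_l_distr M.smult_r_distr M.smult_assoc1)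
qed

lemma additive_bij_int_basis:
  assumes G: "abelian_group G" and H: "abelian_group H" and h: "additive_map G H h"
    and bij: "bij_betw h (carrier G) (carrier H)" and B: "int_basis G B"
  shows "int_basis H (h ` B)"
proof -
  interpret G: based_group G B
    using G B by (simp add: based_group_def based_group_axioms_def)
  interpret H: abelian_group H by (rule H)
  have inj: "inj_on h (carrier G)" and img: "h ` carrier G = carrier H"
    using bij by (auto simp: bij_betw_def)
  have injB: "inj_on h B" using inj G.B_closed by (rule inj_on_subset)
  have hB: "h ` B \<subseteq> carrier H" using G.B_closed img by blast
  have lc: "h (lin_comb G B (\<lambda>b. c (h b))) = lin_comb H (h ` B) c" for c
    by (rule additive_map_lin_comb_inj[OF G H h G.finite_B G.B_closed injB])
  have "\<exists>!c. c \<in> h ` B \<rightarrow>\<^sub>E (UNIV :: int set) \<and> y = lin_comb H (h ` B) c"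
    if "y \<in> carrier H" for y
  proof -
    from that img obtain x where x: "x \<in> carrier G" "y = h x" by blast
    define c where "c = (\<lambda>z\<in>h ` B. coord G B x (inv_into B h z))"
    show ?thesis
    proof (rule ex1I[of _ c])
      have "lin_comb G B (\<lambda>b. c (h b)) = lin_comb G B (coord G B x)"
        using injB G.B_closed by (intro G.lin_comb_cong) (auto simp: c_def)
      then show "c \<in> h ` B \<rightarrow>\<^sub>E UNIV \<and> y = lin_comb H (h ` B) c"
        using lc[of c] x by (simp add: c_def)
    next
      fix c' :: "'c \<Rightarrow> int" assume c': "c' \<in> h ` B \<rightarrow>\<^sub>E UNIV \<and> y = lin_comb H (h ` B) c'"
      then have "h x = h (lin_comb G B (\<lambda>b. c' (h b)))" using lc[of c'] x by simp
      then have "x = lin_comb G B (\<lambda>b. c' (h b))"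
        using inj x G.B_closed by (auto dest: inj_onD)
      then have "coord G B x b = c' (h b)" if "b \<in> B" for b
        using that by simp
      then show "c' = c" using c' injB by (intro extensionalityI[of _ "h ` B"]) (auto simp: c_def PiE_def)
    qed
  qed
  then show ?thesis using G.finite_B hB by (simp add: int_basis_iff_lin_comb)
qed

text \<open>Both isomorphisms of the main result are instances of this transport of structure, with the direct
  sum and with the lattice of real numbers as target.\<close>

lemma zplus_module_transfer:
  assumes M: "zplus_module R E M B" and E: "E \<subseteq> carrier R"
    and h: "h \<in> linear_maps R M M'" and bij: "bij_betw h (carrier M) (carrier M')"
    and zero: "h \<zero>\<^bsub>M\<^esub> = \<zero>\<^bsub>M'\<^esub>"
  shows "zplus_isomorphic R E M B M' (h ` B)"
proof -
  interpret M: zplus_module R E M B by (rule M)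
  interpret M: based_group M B by (rule M.based_group)
  have mod: "Module.module R M'"
    by (rule linear_bij_module[OF M.module_axioms h bij zero])
  interpret M': Module.module R M' by (rule mod)
  note add = linear_maps_additive[OF h]
  have inj: "inj_on h B"
    using bij M.B_closed by (auto simp: bij_betw_def intro: inj_on_subset)
  have "\<exists>c. (\<forall>b\<in>h ` B. c b \<ge> 0) \<and> x \<odot>\<^bsub>M'\<^esub> h m = lin_comb M' (h ` B) c"
    if x: "x \<in> E" and m: "m \<in> B" for x m
  proof -
    obtain c where c: "\<forall>b\<in>B. c b \<ge> 0" "x \<odot>\<^bsub>M\<^esub> m = lin_comb M B c"
      using M x m unfolding zplus_module_iff by blast
    have "lin_comb M B c = lin_comb M B (\<lambda>b. c (inv_into B h (h b)))"
      using inj M.B_closed by (intro M.lin_comb_cong) auto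
    then have "x \<odot>\<^bsub>M'\<^esub> h m = lin_comb M' (h ` B) (\<lambda>b. c (inv_into B h b))"
      using additive_map_lin_comb_inj[OF M.abelian_group_axioms M'.abelian_group_axioms add
          M.finite_B M.B_closed inj, of "\<lambda>b. c (inv_into B h b)"] c(2)
        linear_maps_smult[OF h, of x m] x m E by auto
    with c(1) show ?thesis by (intro exI[of _ "\<lambda>b. c (inv_into B h b)"]) (auto simp: inv_into_into inj)
  qed
  then have "zplus_module R E M' (h ` B)"
    unfolding zplus_module_iff
    using mod M.basis_nonempty
      additive_bij_int_basis[OF M.abelian_group_axioms M'.abelian_group_axioms add bij M.basis]
    by auto
  moreover have "bij_betw h B (h ` B)" using inj by (simp add: bij_betw_def)
  ultimately show ?thesis using M h by (auto simp: zplus_isomorphic_def)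
qed

text \<open>Finite sums formed in the submodule and in \<open>M\<close> are different terms; the inclusion, being additive,
  identifies them.\<close>

lemma zplus_module_span:
  assumes M: "zplus_module R E M B" and T: "T \<subseteq> B" "T \<noteq> {}" and E: "E \<subseteq> carrier R"
    and sub: "submodule (int_span M T) R M"
  shows "zplus_module R E (M\<lparr>carrier := int_span M T\<rparr>) T"
proof -
  interpret M: zplus_module R E M B by (rule M)
  interpret M: based_group M B by (rule M.based_group)
  let ?H = "int_span M T"
  let ?S = "M\<lparr>carrier := ?H\<rparr>"
  interpret H: submodule ?H R M by (rule sub)
  have mod: "Module.module R ?S" by (rule H.submodule_is_module[OF M.module_axioms])
  interpret S: Module.module R ?S by (rule mod)
  have H: "x \<in> ?H \<longleftrightarrow> x \<in> carrier M \<and> (\<forall>b\<in>B - T. coord M B x b = 0)" for x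
    by (rule M.span_iff[OF T(1)])
  have TH: "T \<subseteq> ?H"
  proof
    fix b assume "b \<in> T"
    with T(1) have "b \<in> B" "\<And>b'. b' \<in> B - T \<Longrightarrow> b' \<noteq> b" by auto
    then show "b \<in> ?H" by (auto simp: H M.coord_basis)
  qed
  have finT: "finite T" using T M.finite_B finite_subset by blast
  have lc: "lin_comb ?S T c = lin_comb M T c" for c
  proof -
    have "additive_map ?S M id" by (auto simp: additive_map_def H)
    from additive_map_lin_comb[OF S.abelian_group_axioms M.abelian_group_axioms this finT, of c]
    show ?thesis using TH by (simp add: lin_comb_def)
  qed
  have coord_T: "coord M B (lin_comb M T c) b = c b" if "b \<in> T" for c b
    using that T M.lin_comb_subset[OF M.finite_B M.B_closed T(1), of c] by auto
  have "int_basis ?S T"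
    unfolding int_basis_iff_lin_comb lc
  proof (intro conjI ballI)
    fix x assume "x \<in> carrier ?S"
    then obtain c where c: "x = lin_comb M T c" by (auto simp: int_span_iff_lin_comb)
    show "\<exists>!c. c \<in> T \<rightarrow>\<^sub>E (UNIV :: int set) \<and> x = lin_comb M T c"
    proof (rule ex1I[of _ "restrict c T"])
      have "lin_comb M T c = lin_comb M T (restrict c T)"
        using T M.B_closed by (intro M.lin_comb_cong) auto
      then show "restrict c T \<in> T \<rightarrow>\<^sub>E UNIV \<and> x = lin_comb M T (restrict c T)" using c by simp
    next
      fix c' :: "'c \<Rightarrow> int" assume c': "c' \<in> T \<rightarrow>\<^sub>E UNIV \<and> x = lin_comb M T c'"
      then have "c' b = c b" if "b \<in> T" for b using coord_T[OF that] c by metis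
      then show "c' = restrict c T"
        using c' by (intro extensionalityI[of _ T]) (auto simp: PiE_def)
    qed
  qed (use TH finT in auto)
  moreover have "\<exists>c. (\<forall>b\<in>T. c b \<ge> 0) \<and> x \<odot>\<^bsub>?S\<^esub> m = lin_comb ?S T c"
    if x: "x \<in> E" and m: "m \<in> T" for x m
  proof -
    obtain c where c: "\<forall>b\<in>B. c b \<ge> 0" "x \<odot>\<^bsub>M\<^esub> m = lin_comb M B c"
      using M x m T unfolding zplus_module_iff by blast
    have "x \<odot>\<^bsub>M\<^esub> m \<in> ?H" using x m E TH by auto
    then obtain c' where c': "x \<odot>\<^bsub>M\<^esub> m = lin_comb M T c'" by (auto simp: int_span_iff_lin_comb)
    have "c' b = c b" if "b \<in> T" for b
      using coord_T[OF that, of c'] c(2) c' that T by auto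
    then show ?thesis using c c' T by (intro exI[of _ c']) (auto simp: lc)
  qed
  ultimately show ?thesis unfolding zplus_module_iff using mod T(2) by blast
qed

lemma (in zplus_module) smult_coord_nonneg:
  assumes "x \<in> E" "m \<in> B" "b \<in> B"
  shows "coord M B (x \<odot>\<^bsub>M\<^esub> m) b \<ge> 0"
proof -
  interpret M: based_group M B by (rule based_group)
  obtain c where "\<forall>b\<in>B. c b \<ge> 0" "x \<odot>\<^bsub>M\<^esub> m = lin_comb M B c"
    using zplus_module_axioms assms unfolding zplus_module_iff by blast
  with assms show ?thesis by simp
qed


section \<open>Direct sum decompositions\<close>

lemma direct_sum_simps [simp]:
  "carrier (direct_sum I M) = (\<Pi>\<^sub>E i\<in>I. carrier (M i))"
  "\<zero>\<^bsub>direct_sum I M\<^esub> = (\<lambda>i\<in>I. \<zero>\<^bsub>M i\<^esub>)"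
  "x \<oplus>\<^bsub>direct_sum I M\<^esub> y = (\<lambda>i\<in>I. x i \<oplus>\<^bsub>M i\<^esub> y i)"
  "a \<odot>\<^bsub>direct_sum I M\<^esub> x = (\<lambda>i\<in>I. a \<odot>\<^bsub>M i\<^esub> x i)"
  by (simp_all add: direct_sum_def)

text \<open>The isomorphism sends \<open>x\<close> to the family of its projections. Each projection is linear: on a basis
  element \<open>b \<in> T k\<close> it is the identity or zero on the whole submodule spanned by \<open>T k\<close>, which contains
  the multiples of \<open>b\<close>.\<close>

lemma direct_sum_decomposition:
  fixes M :: "('a, 'b) module"
  assumes M: "zplus_module R E M B" and E: "E \<subseteq> carrier R"
    and union: "(\<Union>i\<in>I. T i) = B"
    and disj: "\<And>i k. i \<in> I \<Longrightarrow> k \<in> I \<Longrightarrow> i \<noteq> k \<Longrightarrow> T i \<inter> T k = {}"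
    and sub: "\<And>i. i \<in> I \<Longrightarrow> submodule (int_span M (T i)) R M"
  defines "Ms \<equiv> \<lambda>i. M\<lparr>carrier := int_span M (T i)\<rparr>"
  shows "zplus_isomorphic R E M B (direct_sum I Ms) (direct_sum_basis I Ms T)"
proof -
  interpret M: zplus_module R E M B by (rule M)
  interpret M: based_group M B by (rule M.based_group)
  have T: "T i \<subseteq> B" if "i \<in> I" for i using that union by blast
  have proj_smult: "M.proj (T i) (a \<odot>\<^bsub>M\<^esub> m) = a \<odot>\<^bsub>M\<^esub> M.proj (T i) m"
    if i: "i \<in> I" and a: "a \<in> carrier R" and m: "m \<in> carrier M" for i a m
  proof -
    have 1: "additive_map M M (\<lambda>m. M.proj (T i) (a \<odot>\<^bsub>M\<^esub> m))"
      using M.additive_proj[of "T i"] a by (auto simp: additive_map_def M.smult_r_distr)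
    have 2: "additive_map M M (\<lambda>m. a \<odot>\<^bsub>M\<^esub> M.proj (T i) m)"
      using M.additive_proj[of "T i"] a by (auto simp: additive_map_def M.smult_r_distr)
    show ?thesis
    proof (rule M.additive_map_eqI[OF M.abelian_group_axioms 1 2 _ m])
      fix b assume "b \<in> B"
      then obtain k where k: "k \<in> I" "b \<in> T k" using union by blast
      have b: "b \<in> int_span M (T k)" by (rule M.basis_in_span[OF T[OF k(1)] k(2)])
      have ab: "a \<odot>\<^bsub>M\<^esub> b \<in> int_span M (T k)"
        by (rule submodule.smult_closed[OF sub[OF k(1)] a b])
      show "M.proj (T i) (a \<odot>\<^bsub>M\<^esub> b) = a \<odot>\<^bsub>M\<^esub> M.proj (T i) b"
      proof (cases "i = k")
        case True
        then show ?thesis using M.proj_of_span[OF T[OF k(1)]] b ab by simp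
      next
        case False
        then show ?thesis
          using M.proj_disjoint[OF T[OF k(1)] b disj] M.proj_disjoint[OF T[OF k(1)] ab disj] k i a
          by simp
      qed
    qed
  qed
  define \<phi> where "\<phi> x = (\<lambda>i\<in>I. M.proj (T i) x)" for x
  have lin: "\<phi> \<in> linear_maps R M (direct_sum I Ms)"
    using M.additive_proj proj_smult T
    by (auto simp: linear_maps_def \<phi>_def Ms_def M.proj_in_span additive_map_def intro!: restrict_ext)
  have zero: "\<phi> \<zero>\<^bsub>M\<^esub> = \<zero>\<^bsub>direct_sum I Ms\<^esub>"
    using additive_map_zero[OF M.abelian_group_axioms M.abelian_group_axioms M.additive_proj]
    by (auto simp: \<phi>_def Ms_def intro!: restrict_ext)
  have bij: "bij_betw \<phi> (carrier M) (carrier (direct_sum I Ms))"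
    unfolding bij_betw_def
  proof
    show "inj_on \<phi> (carrier M)"
    proof (rule inj_onI)
      fix x y assume xy: "x \<in> carrier M" "y \<in> carrier M" and eq: "\<phi> x = \<phi> y"
      show "x = y"
      proof (rule M.coord_eqI[OF xy])
        fix b assume b: "b \<in> B"
        then obtain i where i: "i \<in> I" "b \<in> T i" using union by blast
        have "M.proj (T i) x = M.proj (T i) y"
          using fun_cong[OF eq, of i] i by (simp add: \<phi>_def)
        then have "coord M B (M.proj (T i) x) b = coord M B (M.proj (T i) y) b" by simp
        then show "coord M B x b = coord M B y b" using b i by simp
      qed
    qed
    show "\<phi> ` carrier M = carrier (direct_sum I Ms)"
    proof
      show "\<phi> ` carrier M \<subseteq> carrier (direct_sum I Ms)"
        using lin by (auto simp: linear_maps_def)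
      show "carrier (direct_sum I Ms) \<subseteq> \<phi> ` carrier M"
      proof
        fix y assume y: "y \<in> carrier (direct_sum I Ms)"
        then have yi: "y i \<in> int_span M (T i)" if "i \<in> I" for i
          using that by (auto simp: Ms_def PiE_def Pi_def)
        define idx where "idx b = (SOME i. i \<in> I \<and> b \<in> T i)" for b
        have idx: "idx b = i" if "i \<in> I" "b \<in> T i" for i b
          unfolding idx_def using that disj by (intro some_equality) auto
        define x where "x = lin_comb M B (\<lambda>b. coord M B (y (idx b)) b)"
        have x: "x \<in> carrier M" using M.B_closed by (simp add: x_def)
        have "M.proj (T i) x = y i" if i: "i \<in> I" for i
        proof (rule M.coord_eqI)
          fix b assume "b \<in> B"
          then show "coord M B (M.proj (T i) x) b = coord M B (y i) b"
            using idx[OF i] yi[OF i] M.span_iff[OF T[OF i]] by (auto simp: x_def)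
        qed (use yi[OF i] M.span_iff[OF T[OF i]] in auto)
        then have "y = \<phi> x"
          using y by (intro extensionalityI[of _ I]) (auto simp: \<phi>_def PiE_def)
        with x show "y \<in> \<phi> ` carrier M" by blast
      qed
    qed
  qed
  have basis_img: "\<phi> b = (\<lambda>k\<in>I. if k = i then b else \<zero>\<^bsub>Ms k\<^esub>)" if i: "i \<in> I" and b: "b \<in> T i" for i b
    unfolding \<phi>_def
  proof (rule restrict_ext)
    fix k assume k: "k \<in> I"
    have sp: "b \<in> int_span M (T i)" by (rule M.basis_in_span[OF T[OF i] b])
    show "M.proj (T k) b = (if k = i then b else \<zero>\<^bsub>Ms k\<^esub>)"
      using M.proj_of_span[OF T[OF i] sp] M.proj_disjoint[OF T[OF i] sp disj[OF i k]]
      by (auto simp: Ms_def)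
  qed
  have "\<phi> ` B = (\<Union>i\<in>I. \<phi> ` T i)" using union by blast
  also have "\<dots> = direct_sum_basis I Ms T"
    unfolding direct_sum_basis_def by (intro SUP_cong image_cong refl basis_img)
  finally have "\<phi> ` B = direct_sum_basis I Ms T" .
  then show ?thesis using zplus_module_transfer[OF M E lin bij zero] by simp
qed


section \<open>Modules over rings of radicals\<close>

abbreviation radical :: "(nat \<Rightarrow> nat) \<Rightarrow> (nat \<Rightarrow> nat) \<Rightarrow> nat \<Rightarrow> real" where
  "radical d N j \<equiv> real (d j) powr (1 / real (N j))"

lemma radical_ring_simps [simp]:
  "x \<oplus>\<^bsub>radical_ring J d N\<^esub> y = x + y" "x \<otimes>\<^bsub>radical_ring J d N\<^esub> y = x * y"
  "\<one>\<^bsub>radical_ring J d N\<^esub> = 1" "\<zero>\<^bsub>radical_ring J d N\<^esub> = 0"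
  by (simp_all add: radical_ring_def ring_of_type_algebra_def)

lemma carrier_radical_ring:
  "carrier (radical_ring J d N) = generate_ring ring_of_type_algebra (radical d N ` J)"
  by (simp add: radical_ring_def)

lemma ring_of_type_algebra_simps:
  "x \<oplus>\<^bsub>ring_of_type_algebra\<^esub> y = x + y" "x \<otimes>\<^bsub>ring_of_type_algebra\<^esub> y = x * y"
  "\<one>\<^bsub>ring_of_type_algebra\<^esub> = (1 :: real)" "\<ominus>\<^bsub>ring_of_type_algebra\<^esub> x = - x"
  for x y :: real
proof -
  interpret ring "ring_of_type_algebra :: real ring" by (rule ring_from_type_algebra)
  show "x \<oplus>\<^bsub>ring_of_type_algebra\<^esub> y = x + y" "x \<otimes>\<^bsub>ring_of_type_algebra\<^esub> y = x * y"
    "\<one>\<^bsub>ring_of_type_algebra\<^esub> = (1 :: real)"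
    by (simp_all add: ring_of_type_algebra_def)
  show "\<ominus>\<^bsub>ring_of_type_algebra\<^esub> x = - x"
    by (rule minus_equality) (auto simp: ring_of_type_algebra_def)
qed

lemma cring_radical_ring: "cring (radical_ring J d N)"
proof -
  interpret cring "ring_of_type_algebra :: real ring" by (rule cring_from_type_algebra)
  have "radical d N ` J \<subseteq> carrier ring_of_type_algebra"
    by (simp add: ring_of_type_algebra_def)
  then have "subcring (carrier (radical_ring J d N)) ring_of_type_algebra"
    unfolding carrier_radical_ring by (intro subcringI' generate_ring_is_subring)
  then show ?thesis
    using subcring_iff[of "carrier (radical_ring J d N)"]
    by (simp add: radical_ring_def ring_of_type_algebra_def)
qed

lemma radical_ring_induct [consumes 1, case_names one radical minus add mult]:
  assumes "x \<in> carrier (radical_ring J d N)"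
    and "P 1" and "\<And>j. j \<in> J \<Longrightarrow> P (radical d N j)"
    and "\<And>x. x \<in> carrier (radical_ring J d N) \<Longrightarrow> P x \<Longrightarrow> P (- x)"
    and "\<And>x y. x \<in> carrier (radical_ring J d N) \<Longrightarrow> y \<in> carrier (radical_ring J d N) \<Longrightarrow>
      P x \<Longrightarrow> P y \<Longrightarrow> P (x + y)"
    and "\<And>x y. x \<in> carrier (radical_ring J d N) \<Longrightarrow> y \<in> carrier (radical_ring J d N) \<Longrightarrow>
      P x \<Longrightarrow> P y \<Longrightarrow> P (x * y)"
  shows "P x"
  using assms(1) unfolding carrier_radical_ring
  by (induction rule: generate_ring.induct)
    (use assms(2-) in \<open>auto simp: ring_of_type_algebra_simps carrier_radical_ring\<close>)

lemma radical_ring_closed: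
  shows one_radical_ring: "1 \<in> carrier (radical_ring J d N)"
    and radical_in_ring: "j \<in> J \<Longrightarrow> radical d N j \<in> carrier (radical_ring J d N)"
    and add_radical_ring: "x \<in> carrier (radical_ring J d N) \<Longrightarrow> y \<in> carrier (radical_ring J d N) \<Longrightarrow>
      x + y \<in> carrier (radical_ring J d N)"
    and mult_radical_ring: "x \<in> carrier (radical_ring J d N) \<Longrightarrow> y \<in> carrier (radical_ring J d N) \<Longrightarrow>
      x * y \<in> carrier (radical_ring J d N)"
    and minus_radical_ring: "x \<in> carrier (radical_ring J d N) \<Longrightarrow> - x \<in> carrier (radical_ring J d N)"
  unfolding carrier_radical_ring
  using generate_ring.intros[where R = "ring_of_type_algebra :: real ring" and H = "radical d N ` J"]
  by (simp_all add: ring_of_type_algebra_simps)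

lemma power_radical_ring:
  "x \<in> carrier (radical_ring J d N) \<Longrightarrow> x ^ k \<in> carrier (radical_ring J d N)"
  by (induction k) (auto intro: one_radical_ring mult_radical_ring)

lemma of_nat_radical_ring: "real k \<in> carrier (radical_ring J d N)"
proof (induction k)
  case 0
  show ?case using add_radical_ring[OF one_radical_ring minus_radical_ring[OF one_radical_ring]] by simp
next
  case (Suc k)
  then show ?case using add_radical_ring[OF one_radical_ring] by simp
qed

lemma of_int_radical_ring: "real_of_int k \<in> carrier (radical_ring J d N)"
  by (cases k rule: int_cases2) (auto intro: of_nat_radical_ring minus_radical_ring)

lemma radical_ring_mono:
  assumes "J \<subseteq> K"
  shows "carrier (radical_ring J d N) \<subseteq> carrier (radical_ring K d N)"
proof
  fix x assume "x \<in> carrier (radical_ring J d N)"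
  then show "x \<in> carrier (radical_ring K d N)"
    by (induction rule: radical_ring_induct) (use assms in \<open>auto intro: radical_ring_closed\<close>)
qed

lemma powr_eq_radical_power:
  assumes "d j > 0"
  shows "real (d j) powr (real k / real (N j)) = radical d N j ^ k"
  using assms by (simp add: powr_powr powr_realpow[symmetric])

lemma radical_basis_subset:
  assumes "finite J" "\<And>j. j \<in> J \<Longrightarrow> d j > 0"
  shows "radical_basis J d N \<subseteq> carrier (radical_ring J d N)"
proof
  fix x assume "x \<in> radical_basis J d N"
  then obtain i where x: "x = (\<Prod>j\<in>J. real (d j) powr (real (i j) / real (N j)))"
    by (auto simp: radical_basis_def)
  have "(\<Prod>j\<in>K. real (d j) powr (real (i j) / real (N j))) \<in> carrier (radical_ring J d N)"
    if "K \<subseteq> J" for K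
    using finite_subset[OF that assms(1)] that
  proof (induction K rule: finite_induct)
    case (insert k F)
    then have "real (d k) powr (real (i k) / real (N k)) \<in> carrier (radical_ring J d N)"
      using assms(2)[of k] by (auto simp: powr_eq_radical_power intro: power_radical_ring radical_in_ring)
    with insert show ?case by (auto intro: mult_radical_ring)
  qed (simp add: one_radical_ring)
  with x show "x \<in> carrier (radical_ring J d N)" by simp
qed

lemma radical_basis_mono:
  assumes "finite K" "J \<subseteq> K" "\<And>j. j \<in> K \<Longrightarrow> d j > 0" "\<And>j. j \<in> K \<Longrightarrow> N j > 0"
  shows "radical_basis J d N \<subseteq> radical_basis K d N"
proof
  fix x assume "x \<in> radical_basis J d N"
  then obtain i where i: "x = (\<Prod>j\<in>J. real (d j) powr (real (i j) / real (N j)))" "\<forall>j\<in>J. i j < N j"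
    by (auto simp: radical_basis_def)
  define i' where "i' j = (if j \<in> J then i j else 0)" for j
  have "x = (\<Prod>j\<in>K. real (d j) powr (real (i' j) / real (N j)))"
    unfolding i(1) using assms
    by (intro prod.mono_neutral_cong_left) (auto simp: i'_def)
  moreover have "\<forall>j\<in>K. i' j < N j" using i(2) assms(4) by (auto simp: i'_def)
  ultimately show "x \<in> radical_basis K d N" unfolding radical_basis_def by blast
qed

lemma radical_power_in_basis:
  assumes "k < N j" "d j > 0"
  shows "radical d N j ^ k \<in> radical_basis {j} d N"
  unfolding radical_basis_def using assms
  by (auto intro!: exI[of _ "\<lambda>_. k"] simp: powr_eq_radical_power)

lemma radical_power_eq:
  assumes "d j > 0" "N j > 0"
  shows "radical d N j ^ N j = real (d j)"
  using assms powr_eq_radical_power[of d j "N j" N] by simp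

lemma restrict_scalars:
  assumes "Module.module (radical_ring K d N) M" "J \<subseteq> K"
  shows "Module.module (radical_ring J d N) M"
proof -
  interpret M: Module.module "radical_ring K d N" M by fact
  have sub: "x \<in> carrier (radical_ring K d N)" if "x \<in> carrier (radical_ring J d N)" for x
    using that radical_ring_mono[OF assms(2)] by blast
  show ?thesis
  proof (rule Module.moduleI)
    fix a b x assume ab: "a \<in> carrier (radical_ring J d N)" "b \<in> carrier (radical_ring J d N)"
      and x: "x \<in> carrier M"
    show "(a \<oplus>\<^bsub>radical_ring J d N\<^esub> b) \<odot>\<^bsub>M\<^esub> x = a \<odot>\<^bsub>M\<^esub> x \<oplus>\<^bsub>M\<^esub> b \<odot>\<^bsub>M\<^esub> x"
      using M.smult_l_distr[OF sub sub x, OF ab] by simp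
    show "(a \<otimes>\<^bsub>radical_ring J d N\<^esub> b) \<odot>\<^bsub>M\<^esub> x = a \<odot>\<^bsub>M\<^esub> (b \<odot>\<^bsub>M\<^esub> x)"
      using M.smult_assoc1[OF sub sub x, OF ab] by simp
  next
    fix x assume "x \<in> carrier M"
    then show "\<one>\<^bsub>radical_ring J d N\<^esub> \<odot>\<^bsub>M\<^esub> x = x" using M.smult_one[of x] by simp
  qed (auto intro: cring_radical_ring M.abelian_group_axioms sub M.smult_r_distr)
qed

lemma restrict_scalars_zplus:
  assumes M: "zplus_module (radical_ring K d N) (radical_basis K d N) M B" and "J \<subseteq> K" "finite K"
    and pos: "\<And>j. j \<in> K \<Longrightarrow> d j > 0" "\<And>j. j \<in> K \<Longrightarrow> N j > 0"
  shows "zplus_module (radical_ring J d N) (radical_basis J d N) M B"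
proof -
  interpret M: zplus_module "radical_ring K d N" "radical_basis K d N" M B by (rule M)
  have sub: "radical_basis J d N \<subseteq> radical_basis K d N"
    by (rule radical_basis_mono[OF assms(3,2) pos])
  show ?thesis
    by (intro zplus_module.intro zplus_module_axioms.intro restrict_scalars[OF M.module_axioms assms(2)]
        M.basis M.basis_nonempty M.nonneg subsetD[OF sub])
qed

locale radical_module = M: Module.module "radical_ring J d N" M
  for J :: "nat set" and d N :: "nat \<Rightarrow> nat" and M :: "(real, 'm, 'z) module_scheme"
begin

abbreviation "Rad \<equiv> radical_ring J d N"

lemma minus_smult: "x \<in> carrier Rad \<Longrightarrow> m \<in> carrier M \<Longrightarrow> (- x) \<odot>\<^bsub>M\<^esub> m = \<ominus>\<^bsub>M\<^esub> (x \<odot>\<^bsub>M\<^esub> m)"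
proof -
  assume x: "x \<in> carrier Rad" and m: "m \<in> carrier M"
  have "\<ominus>\<^bsub>Rad\<^esub> x = - x"
    by (rule M.R.minus_equality) (use x in \<open>auto intro: minus_radical_ring\<close>)
  then show ?thesis using M.smult_l_minus[OF x m] by simp
qed

lemma add_smult: "x \<in> carrier Rad \<Longrightarrow> y \<in> carrier Rad \<Longrightarrow> m \<in> carrier M \<Longrightarrow>
    (x + y) \<odot>\<^bsub>M\<^esub> m = x \<odot>\<^bsub>M\<^esub> m \<oplus>\<^bsub>M\<^esub> y \<odot>\<^bsub>M\<^esub> m"
  using M.smult_l_distr[of x y m] by simp

lemma mult_smult: "x \<in> carrier Rad \<Longrightarrow> y \<in> carrier Rad \<Longrightarrow> m \<in> carrier M \<Longrightarrow>
    (x * y) \<odot>\<^bsub>M\<^esub> m = x \<odot>\<^bsub>M\<^esub> (y \<odot>\<^bsub>M\<^esub> m)"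
  using M.smult_assoc1[of x y m] by simp

lemma one_smult: "m \<in> carrier M \<Longrightarrow> 1 \<odot>\<^bsub>M\<^esub> m = m"
  using M.smult_one[of m] by simp

lemma of_nat_smult: "m \<in> carrier M \<Longrightarrow> real k \<odot>\<^bsub>M\<^esub> m = add_pow M (int k) m"
proof (induction k)
  case 0
  then show ?case using M.smult_l_null[of m] by simp
next
  case (Suc k)
  then show ?case
    using add_smult[OF one_radical_ring of_nat_radical_ring, of m k] M.int_mult_add[of m 1 "int k"]
    by (simp add: one_smult)
qed

lemma of_int_smult: "m \<in> carrier M \<Longrightarrow> real_of_int k \<odot>\<^bsub>M\<^esub> m = add_pow M k m"
  by (cases k rule: int_cases2)
    (auto simp: of_nat_smult minus_smult of_nat_radical_ring M.int_mult_minus)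

lemma additive_smult: "x \<in> carrier Rad \<Longrightarrow> additive_map M M (\<lambda>m. x \<odot>\<^bsub>M\<^esub> m)"
  by (auto simp: additive_map_def M.smult_r_distr)

lemma smult_int_mult:
  assumes "x \<in> carrier Rad" "m \<in> carrier M"
  shows "x \<odot>\<^bsub>M\<^esub> add_pow M (k :: int) m = add_pow M k (x \<odot>\<^bsub>M\<^esub> m)"
  by (rule additive_map_mult[OF M.abelian_group_axioms M.abelian_group_axioms
        additive_smult[OF assms(1)] assms(2)])

end

locale based_radical_module = radical_module J d N M + M: based_group M B for J d N M B
begin

text \<open>Linearity needs to be tested only for the generators of the ring and on the basis of the module,
  since the scalars that commute with \<open>h\<close> form a subring.\<close>

lemma linear_mapsI:
  assumes M': "Module.module Rad M'" and h: "additive_map M M' h"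
    and gen: "\<And>j b. j \<in> J \<Longrightarrow> b \<in> B \<Longrightarrow> h (radical d N j \<odot>\<^bsub>M\<^esub> b) = radical d N j \<odot>\<^bsub>M'\<^esub> h b"
  shows "h \<in> linear_maps Rad M M'"
proof -
  interpret M': radical_module J d N M' using M' by (simp add: radical_module_def)
  have hc: "h m \<in> carrier M'" if "m \<in> carrier M" for m
    using h that by (auto simp: additive_map_def)
  have hadd: "h (x \<oplus>\<^bsub>M\<^esub> y) = h x \<oplus>\<^bsub>M'\<^esub> h y" if "x \<in> carrier M" "y \<in> carrier M" for x y
    using h that by (auto simp: additive_map_def)
  have "\<forall>m\<in>carrier M. h (x \<odot>\<^bsub>M\<^esub> m) = x \<odot>\<^bsub>M'\<^esub> h m" if "x \<in> carrier Rad" for x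
    using that
  proof (induction rule: radical_ring_induct)
    case one
    then show ?case by (simp add: one_smult M'.one_smult hc)
  next
    case (radical j)
    let ?a = "radical d N j"
    have a: "?a \<in> carrier Rad" using radical by (rule radical_in_ring)
    show ?case
    proof
      fix m assume m: "m \<in> carrier M"
      have 1: "additive_map M M' (\<lambda>m. h (?a \<odot>\<^bsub>M\<^esub> m))"
        using a by (auto simp: additive_map_def hc hadd M.smult_r_distr)
      have 2: "additive_map M M' (\<lambda>m. ?a \<odot>\<^bsub>M'\<^esub> h m)"
        using a by (auto simp: additive_map_def hc hadd M'.M.smult_r_distr)
      show "h (?a \<odot>\<^bsub>M\<^esub> m) = ?a \<odot>\<^bsub>M'\<^esub> h m"
        by (rule M.additive_map_eqI[OF M'.M.abelian_group_axioms 1 2 _ m]) (use gen radical in auto)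
    qed
  next
    case (minus x)
    then show ?case
      using additive_map_minus[OF M.abelian_group_axioms M'.M.abelian_group_axioms h]
      by (simp add: minus_smult M'.minus_smult hc)
  next
    case (add x y)
    then show ?case by (simp add: add_smult M'.add_smult hc hadd)
  next
    case (mult x y)
    then show ?case by (simp add: mult_smult M'.mult_smult hc)
  qed
  then show ?thesis using hc hadd by (auto simp: linear_maps_def)
qed

lemma submodule_spanI:
  assumes T: "T \<subseteq> B"
    and gen: "\<And>j b. j \<in> J \<Longrightarrow> b \<in> T \<Longrightarrow> radical d N j \<odot>\<^bsub>M\<^esub> b \<in> int_span M T"
  shows "submodule (int_span M T) Rad M"
proof -
  let ?H = "int_span M T"
  note H = M.span_iff[OF T]
  have span_add: "x \<oplus>\<^bsub>M\<^esub> y \<in> ?H" if "x \<in> ?H" "y \<in> ?H" for x y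
    using that by (auto simp: H M.coord_add)
  have inv: "\<ominus>\<^bsub>M\<^esub> x \<in> ?H" if "x \<in> ?H" for x
    using that by (auto simp: H M.coord_minus)
  have zero: "\<zero>\<^bsub>M\<^esub> \<in> ?H" by (auto simp: H)
  have int: "add_pow M (k::int) x \<in> ?H" if "x \<in> ?H" for x k
    using that by (auto simp: H M.coord_mult)
  have clo: "x \<in> carrier M" if "x \<in> ?H" for x using that by (simp add: H)
  have "\<forall>m\<in>?H. x \<odot>\<^bsub>M\<^esub> m \<in> ?H" if "x \<in> carrier Rad" for x
    using that
  proof (induction rule: radical_ring_induct)
    case one
    then show ?case by (auto simp: one_smult clo)
  next
    case (radical j)
    let ?a = "radical d N j"
    have a: "?a \<in> carrier Rad" using radical by (rule radical_in_ring)
    show ?case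
    proof
      fix m assume m: "m \<in> ?H"
      have "T \<subseteq> carrier M" "finite T"
        using T M.B_closed M.finite_B finite_subset by auto
      then show "?a \<odot>\<^bsub>M\<^esub> m \<in> ?H" using m
      proof (rule M.span_induct)
        fix k :: int and b assume b: "b \<in> T"
        then have "b \<in> carrier M" using T by auto
        then show "?a \<odot>\<^bsub>M\<^esub> add_pow M k b \<in> ?H"
          using smult_int_mult[OF a] gen[OF radical b] int by simp
      qed (use a zero span_add in \<open>auto simp: M.smult_r_distr\<close>)
    qed
  next
    case (minus x)
    then show ?case by (auto simp: minus_smult clo inv)
  next
    case (add x y)
    then show ?case by (auto simp: add_smult clo span_add)
  next
    case (mult x y)
    then show ?case by (auto simp: mult_smult clo)
  qed
  then show ?thesis
    by (intro M.submoduleI) (auto simp: clo zero inv span_add)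
qed

end


section \<open>Commuting weighted permutations\<close>

text \<open>What remains of the module once the radicals are known to act by
  \<open>\<alpha>\<^sub>j b = a\<^sub>j(b) s\<^sub>j(b)\<close>. The last assumption is the combinatorial form of irreducibility.\<close>

locale weighted_permutations =
  fixes r :: nat and d N :: "nat \<Rightarrow> nat" and B :: "'m set"
    and s :: "nat \<Rightarrow> 'm \<Rightarrow> 'm" and a :: "nat \<Rightarrow> 'm \<Rightarrow> nat"
  assumes finite_B: "finite B"
    and squarefree_d: "j \<in> {1..r} \<Longrightarrow> squarefree (d j)"
    and d_ge: "j \<in> {1..r} \<Longrightarrow> d j \<ge> 2"
    and N_pos: "j \<in> {1..r} \<Longrightarrow> N j > 0"
    and s_closed: "j \<in> {1..r} \<Longrightarrow> b \<in> B \<Longrightarrow> s j b \<in> B"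
    and s_commute: "i \<in> {1..r} \<Longrightarrow> j \<in> {1..r} \<Longrightarrow> b \<in> B \<Longrightarrow> s i (s j b) = s j (s i b)"
    and s_period: "j \<in> {1..r} \<Longrightarrow> b \<in> B \<Longrightarrow> (s j ^^ N j) b = b"
    and a_invariant:
      "i \<in> {1..r} \<Longrightarrow> j \<in> {1..r} \<Longrightarrow> i \<noteq> j \<Longrightarrow> b \<in> B \<Longrightarrow> a j (s i b) = a j b"
    and a_prod: "j \<in> {1..r} \<Longrightarrow> b \<in> B \<Longrightarrow> (\<Prod>k<N j. a j ((s j ^^ k) b)) = d j"
    and transitive: "T \<subseteq> B \<Longrightarrow> T \<noteq> {} \<Longrightarrow>
      (\<And>j b. j \<in> {1..r} \<Longrightarrow> b \<in> T \<Longrightarrow> s j b \<in> T) \<Longrightarrow> T = B"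
begin

lemma iter_closed: "j \<in> {1..r} \<Longrightarrow> b \<in> B \<Longrightarrow> (s j ^^ k) b \<in> B"
  by (induction k) (auto simp: s_closed)

lemma iter_commute1:
  "i \<in> {1..r} \<Longrightarrow> j \<in> {1..r} \<Longrightarrow> b \<in> B \<Longrightarrow> (s i ^^ k) (s j b) = s j ((s i ^^ k) b)"
  by (induction k) (auto simp: s_commute iter_closed)

lemma iter_commute:
  "i \<in> {1..r} \<Longrightarrow> j \<in> {1..r} \<Longrightarrow> b \<in> B \<Longrightarrow>
   (s i ^^ k) ((s j ^^ l) b) = (s j ^^ l) ((s i ^^ k) b)"
  by (induction l) (auto simp: iter_commute1 iter_closed)

lemma iter_mod: "j \<in> {1..r} \<Longrightarrow> b \<in> B \<Longrightarrow> (s j ^^ (k mod N j)) b = (s j ^^ k) b"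
  by (intro funpow_mod_eq s_period)

lemma iter_add_period:
  assumes "j \<in> {1..r}" "b \<in> B"
  shows "(s j ^^ (k + N j * l)) b = (s j ^^ k) b"
  using iter_mod[OF assms, of "k + N j * l"] iter_mod[OF assms, of k] by simp

lemma a_iter:
  "i \<in> {1..r} \<Longrightarrow> j \<in> {1..r} \<Longrightarrow> i \<noteq> j \<Longrightarrow> b \<in> B \<Longrightarrow> a j ((s i ^^ k) b) = a j b"
  by (induction k) (auto simp: a_invariant iter_closed)

text \<open>The sequence of weights along an orbit of \<open>s j\<close> has no period smaller than \<open>N j\<close>: a prime divisor
  of the square-free number \<open>d j\<close> divides exactly one of the \<open>N j\<close> weights in a period.\<close>

lemma a_shift_cong:
  assumes j: "j \<in> {1..r}" and b: "b \<in> B"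
    and eq: "\<And>k. a j ((s j ^^ (k + p)) b) = a j ((s j ^^ (k + q)) b)"
  shows "[p = q] (mod N j)"
proof -
  define f where "f k = a j ((s j ^^ k) b)" for k
  have f_mod: "f (k mod N j) = f k" for k
    using iter_mod[OF j b] by (simp add: f_def)
  have prod_f: "(\<Prod>k<N j. f k) = d j"
    using a_prod[OF j b] by (simp add: f_def)
  obtain l where l: "normalization_semidom_class.prime l" "l dvd d j"
    using d_ge[OF j] prime_factor_nat[of "d j"] by auto
  then obtain m where m: "m < N j" "l dvd f m"
    using prime_dvd_prod_iff[of "{..<N j}" l f] prod_f by auto
  have unique: "m' = m" if m': "m' < N j" "l dvd f m'" for m'
  proof (rule ccontr)
    assume "m' \<noteq> m"
    have "l * l dvd f m' * f m" using m(2) m'(2) by (rule mult_dvd_mono[rotated])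
    also have "f m' * f m = (\<Prod>k\<in>{m', m}. f k)" using \<open>m' \<noteq> m\<close> by simp
    also have "\<dots> dvd (\<Prod>k<N j. f k)" using m(1) m'(1) by (intro prod_dvd_prod_subset) auto
    finally have "l\<^sup>2 dvd d j" using prod_f by (simp add: power2_eq_square)
    then have "is_unit l" using squarefree_d[OF j] by (rule squarefreeD[rotated])
    with l(1) show False using not_prime_unit by blast
  qed
  \<comment> \<open>A natural number with \<open>k \<equiv> m - p\<close>, so that position \<open>k + p\<close> is the one divisible by \<open>l\<close>.\<close>
  define k where "k = m + (N j - 1) * p"
  have kp: "k + p = m + N j * p"
    using N_pos[OF j] by (cases "N j") (auto simp: k_def)
  then have "(k + p) mod N j = m" using m(1) by simp
  then have "l dvd f (k + p)" using f_mod[of "k + p"] m(2) by simp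
  then have "l dvd f (k + q)" using eq[of k] by (simp add: f_def)
  then have "(k + q) mod N j = m"
    using unique[of "(k + q) mod N j"] f_mod[of "k + q"] N_pos[OF j] by simp
  with \<open>(k + p) mod N j = m\<close> have "[k + p = k + q] (mod N j)" by (simp add: cong_def)
  then show ?thesis by (simp add: cong_add_lcancel_nat)
qed

text \<open>The action of the exponent vector \<open>e\<close>, restricted to the first \<open>n\<close> permutations.\<close>

primrec word :: "nat \<Rightarrow> (nat \<Rightarrow> nat) \<Rightarrow> 'm \<Rightarrow> 'm" where
  "word 0 e b = b"
| "word (Suc n) e b = (s (Suc n) ^^ e (Suc n)) (word n e b)"

lemma word_closed: "n \<le> r \<Longrightarrow> b \<in> B \<Longrightarrow> word n e b \<in> B"
  by (induction n) (auto simp: iter_closed)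

lemma word_cong: "(\<And>j. j \<in> {1..n} \<Longrightarrow> e j = e' j) \<Longrightarrow> word n e b = word n e' b"
  by (induction n) auto

lemma word_step:
  "n \<le> r \<Longrightarrow> b \<in> B \<Longrightarrow> i \<in> {1..n} \<Longrightarrow> s i (word n e b) = word n (e(i := Suc (e i))) b"
proof (induction n)
  case (Suc n)
  show ?case
  proof (cases "i = Suc n")
    case True
    have "word n (e(i := Suc (e i))) b = word n e b"
      by (rule word_cong) (use True in auto)
    with True show ?thesis by (simp del: fun_upd_apply add: fun_upd_same)
  next
    case False
    with Suc show ?thesis
      by (simp add: iter_commute1[symmetric] word_closed)
  qed
qed simp

lemma word_mod: "n \<le> r \<Longrightarrow> b \<in> B \<Longrightarrow> word n (\<lambda>j. e j mod N j) b = word n e b"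
  by (induction n) (auto simp: iter_mod word_closed)

text \<open>Only the exponent of \<open>s j\<close> is visible in the weights \<open>a j\<close>, as a shift along the orbit of \<open>s j\<close>.\<close>

lemma a_word:
  "n \<le> r \<Longrightarrow> b \<in> B \<Longrightarrow> j \<in> {1..r} \<Longrightarrow>
   a j ((s j ^^ k) (word n e b)) = a j ((s j ^^ (k + (if j \<le> n then e j else 0))) b)"
proof (induction n arbitrary: k)
  case (Suc n)
  have w: "word n e b \<in> B" using Suc.prems by (simp add: word_closed)
  show ?case
  proof (cases "j = Suc n")
    case True
    then have "(s j ^^ k) (word (Suc n) e b) = (s j ^^ (k + e j)) (word n e b)"
      by (simp add: funpow_add)
    with True Suc show ?thesis by simp
  next
    case False
    have "(s j ^^ k) (word (Suc n) e b) = (s (Suc n) ^^ e (Suc n)) ((s j ^^ k) (word n e b))"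
      using Suc.prems w by (simp add: iter_commute)
    then have "a j ((s j ^^ k) (word (Suc n) e b)) = a j ((s j ^^ k) (word n e b))"
      using False Suc.prems w by (simp add: a_iter iter_closed)
    also have "\<dots> = a j ((s j ^^ (k + (if j \<le> n then e j else 0))) b)"
      using Suc by simp
    also have "(j \<le> n) = (j \<le> Suc n)" using False by auto
    finally show ?thesis .
  qed
qed auto

text \<open>The elements reached from \<open>b0\<close> are closed under every \<open>s j\<close> by \<open>word_step\<close>.\<close>

lemma word_surj:
  assumes "b0 \<in> B" "b \<in> B"
  shows "\<exists>e. b = word r e b0"
proof -
  have "range (\<lambda>e. word r e b0) = B"
  proof (rule transitive)
    fix j b assume j: "j \<in> {1..r}" and "b \<in> range (\<lambda>e. word r e b0)"
    then obtain e where "b = word r e b0" by auto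
    then have "s j b = word r (e(j := Suc (e j))) b0" using word_step[of r b0 j e] j assms by simp
    then show "s j b \<in> range (\<lambda>e. word r e b0)" by auto
  qed (use assms word_closed in auto)
  with assms show ?thesis by auto
qed

text \<open>Exponent vectors with \<open>e j < N j\<close> parametrize \<open>B\<close>: if two of them reach the same element, then the
  weights \<open>a j\<close> along its orbit show that their \<open>j\<close>-th entries are congruent modulo \<open>N j\<close>.\<close>

lemma card_eq_prod:
  assumes b0: "b0 \<in> B"
  shows "card B = (\<Prod>j=1..r. N j)"
proof -
  let ?P = "PiE {1..r} (\<lambda>j. {..<N j})"
  have "inj_on (\<lambda>e. word r e b0) ?P"
  proof (rule inj_onI)
    fix e e' assume e: "e \<in> ?P" "e' \<in> ?P" and eq: "word r e b0 = word r e' b0"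
    have "e j = e' j" if j: "j \<in> {1..r}" for j
    proof -
      have "[e j = e' j] (mod N j)"
      proof (rule a_shift_cong[OF j b0])
        fix k
        show "a j ((s j ^^ (k + e j)) b0) = a j ((s j ^^ (k + e' j)) b0)"
          using a_word[of r b0 j k e] a_word[of r b0 j k e'] j b0 eq by simp
      qed
      moreover have "e j < N j" "e' j < N j" using e j by (auto simp: PiE_def Pi_def)
      ultimately show ?thesis by (simp add: cong_less_modulus_unique_nat)
    qed
    with e show "e = e'" by (metis PiE_ext)
  qed
  moreover have "(\<lambda>e. word r e b0) ` ?P = B"
  proof
    show "(\<lambda>e. word r e b0) ` ?P \<subseteq> B" using b0 by (auto simp: word_closed)
    show "B \<subseteq> (\<lambda>e. word r e b0) ` ?P"
    proof
      fix b assume "b \<in> B"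
      then obtain e where e: "b = word r e b0" using word_surj[OF b0] by blast
      define e' where "e' = (\<lambda>j\<in>{1..r}. e j mod N j)"
      have "word r e' b0 = word r (\<lambda>j. e j mod N j) b0"
        by (rule word_cong) (simp add: e'_def)
      then have "b = word r e' b0" using e word_mod[of r b0 e] b0 by simp
      moreover have "e' \<in> ?P" using N_pos by (auto simp: e'_def)
      ultimately show "b \<in> (\<lambda>e. word r e b0) ` ?P" by blast
    qed
  qed
  ultimately have "card B = card ?P" by (metis card_image)
  also have "\<dots> = (\<Prod>j=1..r. N j)" by (simp add: card_PiE)
  finally show ?thesis .
qed

definition orbit :: "nat \<Rightarrow> 'm \<Rightarrow> 'm set" where
  "orbit j b = (\<lambda>k. (s j ^^ k) b) ` {..<N j}"

lemma iter_in_orbit: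
  assumes "j \<in> {1..r}" "b \<in> B"
  shows "(s j ^^ k) b \<in> orbit j b"
  unfolding orbit_def using iter_mod[OF assms, of k] N_pos[OF assms(1)]
  by (metis imageI lessThan_iff mod_less_divisor)

lemma orbit_subset: "j \<in> {1..r} \<Longrightarrow> b \<in> B \<Longrightarrow> orbit j b \<subseteq> B"
  by (auto simp: orbit_def iter_closed)

lemma inj_on_orbit:
  assumes j: "j \<in> {1..r}" and b: "b \<in> B"
  shows "inj_on (\<lambda>k. (s j ^^ k) b) {..<N j}"
proof (rule inj_onI)
  fix k l assume kl: "k \<in> {..<N j}" "l \<in> {..<N j}" and eq: "(s j ^^ k) b = (s j ^^ l) b"
  have "[k = l] (mod N j)"
  proof (rule a_shift_cong[OF j b])
    fix m show "a j ((s j ^^ (m + k)) b) = a j ((s j ^^ (m + l)) b)"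
      using eq by (simp add: funpow_add)
  qed
  with kl show "k = l" by (simp add: cong_less_modulus_unique_nat)
qed

lemma card_orbit: "j \<in> {1..r} \<Longrightarrow> b \<in> B \<Longrightarrow> card (orbit j b) = N j"
  unfolding orbit_def by (simp add: card_image inj_on_orbit)

lemma orbit_subset_of_mem:
  assumes "j \<in> {1..r}" "b \<in> B" "x \<in> orbit j b"
  shows "orbit j x \<subseteq> orbit j b"
proof
  fix y assume "y \<in> orbit j x"
  then obtain k l where "y = (s j ^^ k) ((s j ^^ l) b)" using assms(3) by (auto simp: orbit_def)
  then have "y = (s j ^^ (k + l)) b" by (simp add: funpow_add)
  with assms show "y \<in> orbit j b" by (simp add: iter_in_orbit)
qed

lemma mem_orbit_sym:
  assumes j: "j \<in> {1..r}" and b: "b \<in> B" and x: "x \<in> orbit j b"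
  shows "b \<in> orbit j x"
proof -
  obtain l where l: "x = (s j ^^ l) b" using x by (auto simp: orbit_def)
  have "(s j ^^ ((N j - 1) * l)) x = (s j ^^ ((N j - 1) * l + l)) b"
    by (simp add: l funpow_add)
  also have "(N j - 1) * l + l = 0 + N j * l"
    using N_pos[OF j] by (cases "N j") auto
  also have "(s j ^^ \<dots>) b = b" using iter_add_period[OF j b, of 0 l] by simp
  finally show ?thesis
    using iter_in_orbit[of j x "(N j - 1) * l"] j b l iter_closed by simp
qed

lemma orbit_eq:
  assumes "j \<in> {1..r}" "b \<in> B" "x \<in> orbit j b"
  shows "orbit j x = orbit j b"
  using assms orbit_subset_of_mem mem_orbit_sym orbit_subset by (meson subset_antisym subsetD)

lemma s_mem_orbit_iff:
  assumes "j \<in> {1..r}" "b \<in> B" "x \<in> B"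
  shows "s j x \<in> orbit j b \<longleftrightarrow> x \<in> orbit j b"
proof -
  have "s j x \<in> orbit j x" using iter_in_orbit[of j x 1] assms by simp
  then have "orbit j (s j x) = orbit j x" using orbit_eq assms by blast
  moreover have "y \<in> orbit j b \<longleftrightarrow> orbit j y = orbit j b" if "y \<in> B" for y
    using that assms orbit_eq[of j b y] iter_in_orbit[of j y 0] by auto
  ultimately show ?thesis using assms by (simp add: s_closed)
qed

text \<open>Undoing the exponent of \<open>s j\<close> in a word that leads from \<open>b0\<close> to \<open>b\<close> gives a point of the orbit of \<open>b\<close>
  that is reached by the other permutations alone, and these preserve \<open>a j\<close>.\<close>

lemma orbit_base_point:
  assumes j: "j \<in> {1..r}" and b0: "b0 \<in> B" and b: "b \<in> B"
  shows "\<exists>x\<in>orbit j b. \<forall>k. a j ((s j ^^ k) x) = a j ((s j ^^ k) b0)"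
proof -
  obtain e where e: "b = word r e b0" using word_surj[OF b0 b] by blast
  define x where "x = (s j ^^ ((N j - 1) * e j)) b"
  have "a j ((s j ^^ k) x) = a j ((s j ^^ k) b0)" for k
  proof -
    have "(s j ^^ k) x = (s j ^^ (k + (N j - 1) * e j)) (word r e b0)"
      by (simp add: x_def e funpow_add)
    then have "a j ((s j ^^ k) x) = a j ((s j ^^ (k + (N j - 1) * e j + e j)) b0)"
      using a_word[of r b0 j "k + (N j - 1) * e j" e] j b0 by simp
    also have "k + (N j - 1) * e j + e j = k + N j * e j"
      using N_pos[OF j] by (cases "N j") auto
    finally show ?thesis using iter_add_period[OF j b0] by simp
  qed
  moreover have "x \<in> orbit j b" unfolding x_def by (rule iter_in_orbit[OF j b])
  ultimately show ?thesis by blast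
qed

lemma orbit_decomposition:
  assumes j: "j \<in> {1..r}" and b0: "b0 \<in> B"
  defines "n \<equiv> (\<Prod>k=1..r. N k) div N j"
  obtains f where "f ` {1..n} \<subseteq> B" "(\<Union>i\<in>{1..n}. orbit j (f i)) = B"
    "\<And>i i'. i \<in> {1..n} \<Longrightarrow> i' \<in> {1..n} \<Longrightarrow> i \<noteq> i' \<Longrightarrow> orbit j (f i) \<inter> orbit j (f i') = {}"
    "\<And>i k. i \<in> {1..n} \<Longrightarrow> a j ((s j ^^ k) (f i)) = a j ((s j ^^ k) b0)"
proof -
  define Q where "Q = orbit j ` B"
  have finite_Q: "finite Q" by (simp add: Q_def finite_B)
  have Union_Q: "\<Union>Q = B"
    using orbit_subset[OF j] iter_in_orbit[OF j, of _ 0] by (auto simp: Q_def)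
  have disj: "Y \<inter> Z = {}" if YZ: "Y \<in> Q" "Z \<in> Q" "Y \<noteq> Z" for Y Z
  proof (rule ccontr)
    assume "Y \<inter> Z \<noteq> {}"
    then obtain x where x: "x \<in> Y" "x \<in> Z" by blast
    obtain y z where "y \<in> B" "Y = orbit j y" "z \<in> B" "Z = orbit j z"
      using YZ(1,2) by (auto simp: Q_def)
    with x have "Y = orbit j x" "Z = orbit j x" using orbit_eq[OF j] by blast+
    with \<open>Y \<noteq> Z\<close> show False by simp
  qed
  have "N j * card Q = card (\<Union>Q)"
    using finite_Q Union_Q finite_B disj card_orbit[OF j]
    by (intro card_partition) (auto simp: Q_def)
  then have "n = N j * card Q div N j"
    using card_eq_prod[OF b0] Union_Q by (simp add: n_def)
  then have "card Q = n" using N_pos[OF j] by simp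
  then obtain h where h: "bij_betw h {1..n} Q"
    using ex_bij_betw_nat_finite_1[OF finite_Q] by auto
  have "\<exists>x\<in>B. orbit j x = h i \<and> (\<forall>k. a j ((s j ^^ k) x) = a j ((s j ^^ k) b0))"
    if i: "i \<in> {1..n}" for i
  proof -
    have "h i \<in> Q" using h i by (auto simp: bij_betw_def)
    then obtain b where b: "b \<in> B" "h i = orbit j b" by (auto simp: Q_def)
    obtain x where x: "x \<in> orbit j b" "\<forall>k. a j ((s j ^^ k) x) = a j ((s j ^^ k) b0)"
      using orbit_base_point[OF j b0 b(1)] by blast
    moreover have "orbit j x = orbit j b" "x \<in> B"
      using orbit_eq[OF j b(1) x(1)] orbit_subset[OF j b(1)] x(1) by auto
    ultimately show ?thesis using b(2) by metis
  qed
  then obtain f where f: "\<And>i. i \<in> {1..n} \<Longrightarrow> f i \<in> B \<and> orbit j (f i) = h i \<and>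
      (\<forall>k. a j ((s j ^^ k) (f i)) = a j ((s j ^^ k) b0))"
    by metis
  have "f ` {1..n} \<subseteq> B" using f by blast
  moreover have "(\<Union>i\<in>{1..n}. orbit j (f i)) = B"
  proof -
    have "(\<Union>i\<in>{1..n}. orbit j (f i)) = (\<Union>i\<in>{1..n}. h i)"
      by (rule SUP_cong[OF refl]) (use f in blast)
    also have "\<dots> = \<Union>Q" using bij_betw_imp_surj_on[OF h] by metis
    finally show ?thesis using Union_Q by (rule trans)
  qed
  moreover have "orbit j (f i) \<inter> orbit j (f i') = {}"
    if "i \<in> {1..n}" "i' \<in> {1..n}" "i \<noteq> i'" for i i'
  proof -
    have "h i \<noteq> h i'"
      using bij_betw_imp_inj_on[OF h] that by (meson inj_on_eq_iff)
    moreover have "h i \<in> Q" "h i' \<in> Q"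
      using bij_betw_apply[OF h] that by blast+
    ultimately have "h i \<inter> h i' = {}" by (intro disj)
    moreover have "orbit j (f i) = h i" "orbit j (f i') = h i'" using f that by blast+
    ultimately show ?thesis by (simp only:)
  qed
  moreover have "a j ((s j ^^ k) (f i)) = a j ((s j ^^ k) b0)" if "i \<in> {1..n}" for i k
    using f[OF that] by blast
  ultimately show thesis by (rule that)
qed

end

section \<open>Radicals act by weighted permutations\<close>

text \<open>Some product \<open>P b c * Q c b\<close> is positive, because the diagonal of \<open>P Q\<close> is. If \<open>e \<noteq> c\<close>, then
  \<open>Q c b * P b e\<close> is one of the non-negative summands of the vanishing entry \<open>(c, e)\<close> of \<open>Q P\<close>, so
  \<open>P b e = 0\<close>.\<close>

lemma nonneg_inverse_pair_monomial:
  fixes P Q :: "'b \<Rightarrow> 'b \<Rightarrow> int" and q :: int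
  assumes B: "finite B" and q: "q > 0"
    and nonneg: "\<And>b c. b \<in> B \<Longrightarrow> c \<in> B \<Longrightarrow> P b c \<ge> 0" "\<And>b c. b \<in> B \<Longrightarrow> c \<in> B \<Longrightarrow> Q b c \<ge> 0"
    and PQ: "\<And>b c. b \<in> B \<Longrightarrow> c \<in> B \<Longrightarrow> (\<Sum>e\<in>B. P b e * Q e c) = (if b = c then q else 0)"
    and QP: "\<And>b c. b \<in> B \<Longrightarrow> c \<in> B \<Longrightarrow> (\<Sum>e\<in>B. Q b e * P e c) = (if b = c then q else 0)"
    and b: "b \<in> B"
  shows "\<exists>c\<in>B. P b c > 0 \<and> (\<forall>e\<in>B. e \<noteq> c \<longrightarrow> P b e = 0)"
proof -
  have "(\<Sum>e\<in>B. P b e * Q e b) \<noteq> 0" using PQ[OF b b] q by simp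
  then obtain c where c: "c \<in> B" "P b c * Q c b \<noteq> 0" by (meson sum.neutral)
  have "P b e = 0" if e: "e \<in> B" "e \<noteq> c" for e
  proof -
    have "(\<Sum>x\<in>B. Q c x * P x e) = 0" using QP[OF c(1) e(1)] e(2) by simp
    then have "Q c b * P b e = 0"
      using sum_nonneg_eq_0_iff[OF B, of "\<lambda>x. Q c x * P x e"] nonneg c(1) e(1) b by auto
    with c show ?thesis by simp
  qed
  moreover have "P b c > 0" using nonneg(1)[OF b c(1)] c(2) by (simp add: order_less_le)
  ultimately show ?thesis using c(1) by blast
qed

lemma (in based_radical_module) power_smult:
  assumes j: "j \<in> J" and b: "b \<in> B"
    and act: "\<And>b. b \<in> B \<Longrightarrow> \<sigma> b \<in> B \<and> radical d N j \<odot>\<^bsub>M\<^esub> b = add_pow M (int (w b)) (\<sigma> b)"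
  shows "(\<sigma> ^^ k) b \<in> B \<and>
    radical d N j ^ k \<odot>\<^bsub>M\<^esub> b = add_pow M (int (\<Prod>m<k. w ((\<sigma> ^^ m) b))) ((\<sigma> ^^ k) b)"
proof (induction k)
  case 0
  then show ?case using b by (simp add: one_smult)
next
  case (Suc k)
  let ?a = "radical d N j"
  let ?b = "(\<sigma> ^^ k) b"
  have a: "?a \<in> carrier Rad" using j by (rule radical_in_ring)
  have "?a ^ Suc k \<odot>\<^bsub>M\<^esub> b = ?a \<odot>\<^bsub>M\<^esub> (?a ^ k \<odot>\<^bsub>M\<^esub> b)"
    using mult_smult[OF a power_radical_ring[OF a, of k], of b] b by simp
  also have "\<dots> = add_pow M (int (\<Prod>m<k. w ((\<sigma> ^^ m) b))) (?a \<odot>\<^bsub>M\<^esub> ?b)"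
    using Suc by (simp add: smult_int_mult[OF a])
  also have "?a \<odot>\<^bsub>M\<^esub> ?b = add_pow M (int (w ?b)) (\<sigma> ?b)"
    using act Suc by blast
  finally show ?case using Suc act[of ?b] by (simp add: M.int_mult_assoc)
qed

locale irreducible_radical_module =
  fixes r :: nat and d N :: "nat \<Rightarrow> nat" and M :: "(real, 'm) module" and B :: "'m set"
  assumes squarefree: "\<And>j. j \<in> {1..r} \<Longrightarrow> squarefree (d j)"
    and d_ge: "\<And>j. j \<in> {1..r} \<Longrightarrow> d j \<ge> 2"
    and coprime: "\<And>i j. i \<in> {1..r} \<Longrightarrow> j \<in> {1..r} \<Longrightarrow> i \<noteq> j \<Longrightarrow> coprime (d i) (d j)"
    and N_ge: "\<And>j. j \<in> {1..r} \<Longrightarrow> N j \<ge> 2"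
    and irreducible:
      "irreducible_zplus_module (radical_ring {1..r} d N) (radical_basis {1..r} d N) M B"
begin

lemma d_pos: "j \<in> {1..r} \<Longrightarrow> d j > 0" and N_pos: "j \<in> {1..r} \<Longrightarrow> N j > 0"
  using d_ge N_ge by fastforce+

lemma zplus: "zplus_module (radical_ring {1..r} d N) (radical_basis {1..r} d N) M B"
  using irreducible by (simp add: irreducible_zplus_module_def)

end

lemma zplus_module_imp_based_radical_module:
  assumes "zplus_module (radical_ring J d N) E M B"
  shows "based_radical_module J d N M B"
proof -
  interpret zplus_module "radical_ring J d N" E M B by (rule assms)
  show ?thesis
    using module_axioms based_group by (simp add: based_radical_module_def radical_module_def)
qed

sublocale irreducible_radical_module \<subseteq> based_radical_module "{1..r}" d N M B
  by (rule zplus_module_imp_based_radical_module[OF zplus])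

sublocale irreducible_radical_module \<subseteq>
  Z: zplus_module "radical_ring {1..r} d N" "radical_basis {1..r} d N" M B
  by (rule zplus)

context irreducible_radical_module
begin

text \<open>The coordinates of the images of basis elements are the entries of the two non-negative matrices
  of \<open>\<alpha>\<^sub>j\<close> and its power with exponent \<open>N j - 1\<close>, which multiply to \<open>d j\<close> times the identity.\<close>

lemma ex_action:
  assumes j: "j \<in> {1..r}" and b: "b \<in> B"
  shows "\<exists>c\<in>B. \<exists>k>0. radical d N j \<odot>\<^bsub>M\<^esub> b = add_pow M (int k) c"
proof -
  let ?a = "radical d N j"
  let ?a' = "?a ^ (N j - 1)"
  have aa': "?a * ?a' = real (d j)" "?a' * ?a = real (d j)"
    using radical_power_eq[of d j N] d_pos[OF j] N_pos[OF j] power_minus_mult[of "N j" ?a]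
    by (simp_all add: mult.commute)
  have a: "?a \<in> carrier Rad" using j by (rule radical_in_ring)
  then have a': "?a' \<in> carrier Rad" by (rule power_radical_ring)
  have "radical_basis {j} d N \<subseteq> radical_basis {1..r} d N"
    using j d_pos N_pos by (intro radical_basis_mono) auto
  then have E: "?a \<in> radical_basis {1..r} d N" "?a' \<in> radical_basis {1..r} d N"
    using radical_power_in_basis[of 1 N j d] radical_power_in_basis[of "N j - 1" N j d]
      d_pos[OF j] N_ge[OF j] by auto
  have prod: "(\<Sum>e\<in>B. coord M B (y \<odot>\<^bsub>M\<^esub> u) e * coord M B (x \<odot>\<^bsub>M\<^esub> e) v) =
      (if u = v then int (d j) else 0)"
    if xy: "x \<in> carrier Rad" "y \<in> carrier Rad" "x * y = real (d j)" and uv: "u \<in> B" "v \<in> B"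
    for x y u v
  proof -
    have "(\<Sum>e\<in>B. coord M B (y \<odot>\<^bsub>M\<^esub> u) e * coord M B (x \<odot>\<^bsub>M\<^esub> e) v) =
        coord M B (x \<odot>\<^bsub>M\<^esub> (y \<odot>\<^bsub>M\<^esub> u)) v"
      using M.coord_additive_map[OF additive_smult[OF xy(1)], of "y \<odot>\<^bsub>M\<^esub> u" v] xy uv by simp
    also have "x \<odot>\<^bsub>M\<^esub> (y \<odot>\<^bsub>M\<^esub> u) = add_pow M (int (d j)) u"
      using mult_smult[OF xy(1,2), of u] xy(3) uv of_nat_smult[of u "d j"] by simp
    also have "coord M B \<dots> v = (if u = v then int (d j) else 0)"
      using uv by (simp add: M.coord_mult M.coord_basis)
    finally show ?thesis .
  qed
  have "\<exists>c\<in>B. coord M B (?a \<odot>\<^bsub>M\<^esub> b) c > 0 \<and> (\<forall>e\<in>B. e \<noteq> c \<longrightarrow> coord M B (?a \<odot>\<^bsub>M\<^esub> b) e = 0)"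
    using M.finite_B _ Z.smult_coord_nonneg[OF E(1)] Z.smult_coord_nonneg[OF E(2)]
      prod[OF a' a aa'(2)] prod[OF a a' aa'(1)] b
    by (rule nonneg_inverse_pair_monomial) (use d_pos[OF j] in auto)
  then obtain c where c: "c \<in> B" "coord M B (?a \<odot>\<^bsub>M\<^esub> b) c > 0"
    "\<And>e. e \<in> B \<Longrightarrow> e \<noteq> c \<Longrightarrow> coord M B (?a \<odot>\<^bsub>M\<^esub> b) e = 0" by blast
  have "?a \<odot>\<^bsub>M\<^esub> b = add_pow M (coord M B (?a \<odot>\<^bsub>M\<^esub> b) c) c"
    by (rule M.coord_eqI) (use a b c in \<open>auto simp: M.coord_mult M.coord_basis\<close>)
  with c show ?thesis
    by (intro bexI[of _ c] exI[of _ "nat (coord M B (?a \<odot>\<^bsub>M\<^esub> b) c)"]) auto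
qed

text \<open>Everything follows by comparing coefficients of basis elements: the period and the product of weights
  from \<open>\<alpha>\<^sub>j\<close> raised to the power \<open>N j\<close>, the commutation from \<open>\<alpha>\<^sub>i \<alpha>\<^sub>j = \<alpha>\<^sub>j \<alpha>\<^sub>i\<close>. The latter also
  gives \<open>a j b * a i (s j b) = a i b * a j (s i b)\<close>, where the weights with index \<open>i\<close> divide \<open>d i\<close> and
  are therefore coprime to those with index \<open>j\<close>.\<close>

lemma ex_weighted_permutations:
  "\<exists>s a. weighted_permutations r d N B s a \<and>
    (\<forall>j\<in>{1..r}. \<forall>b\<in>B. radical d N j \<odot>\<^bsub>M\<^esub> b = add_pow M (int (a j b)) (s j b))"
proof -
  have "\<forall>j b. \<exists>c k. j \<in> {1..r} \<and> b \<in> B \<longrightarrow>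
      c \<in> B \<and> k > 0 \<and> radical d N j \<odot>\<^bsub>M\<^esub> b = add_pow M (int k) c"
    using ex_action by blast
  then obtain s a where sa: "\<And>j b. j \<in> {1..r} \<Longrightarrow> b \<in> B \<Longrightarrow>
      s j b \<in> B \<and> a j b > 0 \<and> radical d N j \<odot>\<^bsub>M\<^esub> b = add_pow M (int (a j b)) (s j b)"
    by metis
  have sB: "s j b \<in> B" and apos: "a j b > 0"
    and act: "radical d N j \<odot>\<^bsub>M\<^esub> b = add_pow M (int (a j b)) (s j b)"
    if "j \<in> {1..r}" "b \<in> B" for j b
    using sa[OF that] by auto
  have rad: "radical d N j \<in> carrier Rad" if "j \<in> {1..r}" for j
    using that by (rule radical_in_ring)
  have full: "(s j ^^ N j) b = b \<and> (\<Prod>k<N j. a j ((s j ^^ k) b)) = d j"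
    if j: "j \<in> {1..r}" and b: "b \<in> B" for j b
  proof -
    have pw: "(s j ^^ N j) b \<in> B" "radical d N j ^ N j \<odot>\<^bsub>M\<^esub> b =
        add_pow M (int (\<Prod>k<N j. a j ((s j ^^ k) b))) ((s j ^^ N j) b)"
      using power_smult[OF j b, of "s j" "a j" "N j"] sa[OF j] by auto
    then have "add_pow M (int (d j)) b = add_pow M (int (\<Prod>k<N j. a j ((s j ^^ k) b))) ((s j ^^ N j) b)"
      using radical_power_eq[of d j N] d_pos[OF j] N_pos[OF j] b by (simp add: of_nat_smult)
    from M.mult_basis_inject[OF b pw(1) _ this] show ?thesis
      using d_pos[OF j] by (auto simp flip: of_nat_prod)
  qed
  have a_dvd: "a j b dvd d j" if j: "j \<in> {1..r}" and b: "b \<in> B" for j b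
  proof -
    have "a j ((s j ^^ 0) b) dvd (\<Prod>k<N j. a j ((s j ^^ k) b))"
      by (rule dvd_prodI) (use N_pos[OF j] in auto)
    then show ?thesis using full[OF j b] by simp
  qed
  have two: "s i (s j b) = s j (s i b) \<and> a j b * a i (s j b) = a i b * a j (s i b)"
    if i: "i \<in> {1..r}" and j: "j \<in> {1..r}" and b: "b \<in> B" for i j b
  proof -
    have comp: "(radical d N p * radical d N q) \<odot>\<^bsub>M\<^esub> b =
        add_pow M (int (a q b * a p (s q b))) (s p (s q b))"
      if p: "p \<in> {1..r}" and q: "q \<in> {1..r}" for p q
    proof -
      have "(radical d N p * radical d N q) \<odot>\<^bsub>M\<^esub> b = radical d N p \<odot>\<^bsub>M\<^esub> (radical d N q \<odot>\<^bsub>M\<^esub> b)"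
        using mult_smult[OF rad[OF p] rad[OF q], of b] b by simp
      also have "\<dots> = add_pow M (int (a q b)) (add_pow M (int (a p (s q b))) (s p (s q b)))"
        using act[OF q b] act[OF p sB[OF q b]] smult_int_mult[OF rad[OF p], of "s q b" "int (a q b)"]
          sB[OF q b] by simp
      finally show ?thesis
        using sB[OF p sB[OF q b]] by (simp add: M.int_mult_assoc)
    qed
    have eq: "add_pow M (int (a j b * a i (s j b))) (s i (s j b)) =
        add_pow M (int (a i b * a j (s i b))) (s j (s i b))"
      using comp[OF i j] comp[OF j i] by (simp add: mult.commute)
    have pos: "int (a j b * a i (s j b)) > 0"
      using apos[OF j b] apos[OF i sB[OF j b]] by simp
    show ?thesis
      using M.mult_basis_inject[OF sB[OF i sB[OF j b]] sB[OF j sB[OF i b]] pos eq]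
      by (simp flip: of_nat_mult)
  qed
  have inv: "a j (s i b) = a j b"
    if i: "i \<in> {1..r}" and j: "j \<in> {1..r}" and ij: "i \<noteq> j" and b: "b \<in> B" for i j b
  proof (rule dvd_antisym)
    have eq: "a j b * a i (s j b) = a i b * a j (s i b)" using two[OF i j b] by simp
    have cop: "coprime (a j x) (a i y)" if "x \<in> B" "y \<in> B" for x y
      using coprime_divisors[OF a_dvd[OF j that(1)] a_dvd[OF i that(2)]] coprime[OF j i] ij by auto
    have "a j b dvd a i b * a j (s i b)" using eq by (metis dvd_triv_left)
    then show "a j b dvd a j (s i b)"
      using cop[OF b b] by (simp add: coprime_dvd_mult_right_iff)
    have "a j (s i b) dvd a j b * a i (s j b)" using eq by simp
    then show "a j (s i b) dvd a j b"
      using cop[OF sB[OF i b] sB[OF j b]] by (simp add: coprime_dvd_mult_left_iff)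
  qed
  have trans: "T = B" if T: "T \<subseteq> B" "T \<noteq> {}"
    and closed: "\<And>j b. j \<in> {1..r} \<Longrightarrow> b \<in> T \<Longrightarrow> s j b \<in> T" for T
  proof -
    have "submodule (int_span M T) Rad M"
      using T(1) act closed M.mult_basis_in_span[OF T(1)]
      by (intro submodule_spanI) auto
    then have "zplus_submodule Rad M B (int_span M T)"
      using T(1) by (auto simp: zplus_submodule_def)
    then have "int_span M T = {\<zero>\<^bsub>M\<^esub>} \<or> int_span M T = carrier M"
      using irreducible by (auto simp: irreducible_zplus_module_def)
    moreover obtain t where t: "t \<in> T" using T(2) by blast
    then have "t \<in> int_span M T" "t \<in> B" using M.basis_in_span[OF T(1)] T(1) by auto
    moreover have "t \<noteq> \<zero>\<^bsub>M\<^esub>"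
      using \<open>t \<in> B\<close> M.coord_basis[of t t] M.coord_zero[of t] by auto
    ultimately have full: "int_span M T = carrier M" by auto
    have "b \<in> T" if "b \<in> B" for b
    proof (rule ccontr)
      assume "b \<notin> T"
      moreover have "b \<in> int_span M T" using that full by simp
      ultimately have "coord M B b b = 0" using M.span_iff[OF T(1)] that by blast
      then show False using M.coord_basis[of b b] that by simp
    qed
    with T(1) show "T = B" by blast
  qed
  have "weighted_permutations r d N B s a"
  proof
    show "T = B" if "T \<subseteq> B" "T \<noteq> {}" "\<And>j b. j \<in> {1..r} \<Longrightarrow> b \<in> T \<Longrightarrow> s j b \<in> T" for T
      using that by (rule trans)
    show "s i (s j b) = s j (s i b)" if "i \<in> {1..r}" "j \<in> {1..r}" "b \<in> B" for i j b
      using two[OF that] by (rule conjunct1)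
    show "(s j ^^ N j) b = b" "(\<Prod>k<N j. a j ((s j ^^ k) b)) = d j"
      if "j \<in> {1..r}" "b \<in> B" for j b
      using full[OF that] by blast+
  qed (fact M.finite_B squarefree d_ge N_pos sB inv)+
  then show ?thesis using act by blast
qed

end

section \<open>The cyclic modules\<close>

lemma real_module_simps [simp]:
  "carrier real_module = UNIV" "x \<oplus>\<^bsub>real_module\<^esub> y = x + y" "\<zero>\<^bsub>real_module\<^esub> = 0"
  "x \<odot>\<^bsub>real_module\<^esub> y = x * y"
  by (simp_all add: real_module_def)

lemma module_real_module: "Module.module (radical_ring J d N) real_module"
proof (rule Module.moduleI)
  show "abelian_group real_module"
  proof (rule abelian_groupI)
    fix x assume "x \<in> carrier real_module"
    show "\<exists>y\<in>carrier real_module. y \<oplus>\<^bsub>real_module\<^esub> x = \<zero>\<^bsub>real_module\<^esub>"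
      by (intro bexI[of _ "- x"]) auto
  qed auto
qed (auto simp: cring_radical_ring algebra_simps)

lemma real_lattice_simps [simp]:
  "carrier (real_lattice G) = int_span real_module G" "x \<oplus>\<^bsub>real_lattice G\<^esub> y = x + y"
  "\<zero>\<^bsub>real_lattice G\<^esub> = 0" "x \<odot>\<^bsub>real_lattice G\<^esub> y = x * y"
  by (simp_all add: real_lattice_def real_module_def)

lemma bij_betw_rotation:
  fixes k n :: nat
  assumes "n > 0"
  shows "bij_betw (\<lambda>i. (k + i) mod n + 1) {..<n} {1..n}"
proof -
  have inj: "inj_on (\<lambda>i. (k + i) mod n + 1) {..<n}"
  proof (rule inj_onI)
    fix i i' assume i: "i \<in> {..<n}" "i' \<in> {..<n}" and "(k + i) mod n + 1 = (k + i') mod n + 1"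
    then have "[k + i = k + i'] (mod n)" by (simp add: cong_def)
    then have "[i = i'] (mod n)" by (simp add: cong_add_lcancel_nat)
    with i show "i = i'" by (simp add: cong_less_modulus_unique_nat)
  qed
  moreover have "(\<lambda>i. (k + i) mod n + 1) ` {..<n} = {1..n}"
  proof (rule card_subset_eq)
    show "(\<lambda>i. (k + i) mod n + 1) ` {..<n} \<subseteq> {1..n}"
      using assms by (auto simp: Suc_le_eq)
    show "card ((\<lambda>i. (k + i) mod n + 1) ` {..<n}) = card {1..n}"
      using inj by (simp add: card_image)
  qed simp
  ultimately show ?thesis by (simp add: bij_betw_def)
qed

lemma cyclic_generator_pos:
  assumes "n > 0" "\<And>k. k \<in> {1..n} \<Longrightarrow> c k > 0"
  shows "cyclic_generator n c k > 0"
  unfolding cyclic_generator_def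
proof (rule prod_pos)
  fix i assume "i \<in> {0..n - 1}"
  have "(k + i - 1) mod n < n" using assms(1) by simp
  then have "c ((k + i - 1) mod n + 1) > 0" by (intro assms(2)) auto
  then show "0 < real (c ((k + i - 1) mod n + 1)) powr (real (n - 1 - i) / real n)" by simp
qed

text \<open>The root of the full product raises every exponent in the generator by \<open>1 / n\<close>. The factor \<open>c k\<close> then
  has exponent \<open>1\<close>, and the others have the exponents prescribed for the next generator.\<close>

lemma cyclic_generator_step:
  assumes n: "n > 0" and c: "\<And>k. k \<in> {1..n} \<Longrightarrow> c k > 0" and k: "k \<in> {1..n}"
  shows "real (\<Prod>k=1..n. c k) powr (1 / real n) * cyclic_generator n c k =
    real (c k) * cyclic_generator n c (k mod n + 1)"
proof -
  obtain k' where k': "k = Suc k'" using k by (cases k) auto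
  obtain p where p: "n = Suc p" using n by (cases n) auto
  define e where "e i = real (c ((k' + i) mod n + 1))" for i
  have e_pos: "e i > 0" for i
  proof -
    have "(k' + i) mod n < n" using n by simp
    then have "c ((k' + i) mod n + 1) > 0" by (intro c) auto
    then show ?thesis by (simp add: e_def)
  qed
  have "real (\<Prod>k=1..n. c k) = (\<Prod>k=1..n. real (c k))" by simp
  also have "\<dots> = (\<Prod>i<n. e i)"
    unfolding e_def using prod.reindex_bij_betw[OF bij_betw_rotation[OF n, of k'], of "\<lambda>k. real (c k)"]
    by simp
  finally have "real (\<Prod>k=1..n. c k) powr (1 / real n) = (\<Prod>i<n. e i powr (1 / real n))"
    using e_pos by (simp add: prod_powr_distrib less_imp_le)
  moreover have "cyclic_generator n c k = (\<Prod>i<n. e i powr (real (p - i) / real n))"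
    unfolding cyclic_generator_def e_def k' using p by (intro prod.cong) auto
  ultimately have "real (\<Prod>k=1..n. c k) powr (1 / real n) * cyclic_generator n c k =
      (\<Prod>i<n. e i powr (1 / real n) * e i powr (real (p - i) / real n))"
    by (simp add: prod.distrib)
  also have "\<dots> = (\<Prod>i<n. e i powr (real (n - i) / real n))"
  proof (rule prod.cong)
    fix i assume "i \<in> {..<n}"
    then have "1 / real n + real (p - i) / real n = real (n - i) / real n"
      using p by (simp add: add_divide_distrib[symmetric] Suc_diff_le)
    then show "e i powr (1 / real n) * e i powr (real (p - i) / real n) = e i powr (real (n - i) / real n)"
      by (simp add: powr_add[symmetric])
  qed simp
  also have "\<dots> = e 0 * (\<Prod>i<p. e (Suc i) powr (real (p - i) / real n))"
    using p e_pos[of 0] by (simp add: prod.lessThan_Suc_shift del: prod.lessThan_Suc)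
  also have "(\<Prod>i<p. e (Suc i) powr (real (p - i) / real n)) =
      (\<Prod>i<n. e (Suc i) powr (real (p - i) / real n))"
    using p e_pos[of "Suc p"] by simp
  also have "\<dots> = cyclic_generator n c (k mod n + 1)"
    unfolding cyclic_generator_def
  proof (rule prod.cong)
    fix i
    have "(k' + Suc i) mod n = (k mod n + 1 + i - 1) mod n"
      by (simp add: k' mod_add_left_eq)
    then show "e (Suc i) powr (real (p - i) / real n) =
        real (c ((k mod n + 1 + i - 1) mod n + 1)) powr (real (n - 1 - i) / real n)"
      using p unfolding e_def by simp
  qed (use p in auto)
  also have "e 0 = real (c k)" using k by (simp add: e_def k')
  finally show ?thesis .
qed

text \<open>Here \<open>T\<close> is the orbit of \<open>x\<close> under \<open>\<sigma>\<close>, and \<open>h\<close> maps its \<open>m\<close>-th point to the \<open>m\<close>-th generator. The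
  point of the proof is that \<open>h\<close> is injective, although nothing is known beforehand about linear
  relations between the generators.\<close>

lemma zplus_module_cyclic_iso:
  fixes d N :: "nat \<Rightarrow> nat" and M :: "(real, 'm) module"
  assumes M: "zplus_module (radical_ring {j} d N) (radical_basis {j} d N) M B"
    and d_pos: "d j > 0" and N_pos: "N j > 0"
    and act: "\<And>b. b \<in> B \<Longrightarrow> \<sigma> b \<in> B \<and> radical d N j \<odot>\<^bsub>M\<^esub> b = add_pow M (int (w b)) (\<sigma> b)"
    and x: "x \<in> B" and period: "(\<sigma> ^^ N j) x = x"
    and inj: "inj_on (\<lambda>m. (\<sigma> ^^ m) x) {..<N j}"
    and prod: "(\<Prod>m<N j. w ((\<sigma> ^^ m) x)) = d j"
    and c: "\<And>m. m < N j \<Longrightarrow> c (Suc m) = w ((\<sigma> ^^ m) x)"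
    and T: "T = (\<lambda>m. (\<sigma> ^^ m) x) ` {..<N j}"
    and compl: "\<And>b. b \<in> B \<Longrightarrow> \<sigma> b \<in> T \<Longrightarrow> b \<in> T"
    and sub: "submodule (int_span M T) (radical_ring {j} d N) M"
  shows "zplus_isomorphic (radical_ring {j} d N) (radical_basis {j} d N)
    (M\<lparr>carrier := int_span M T\<rparr>) T (cyclic_module (N j) c) (cyclic_basis (N j) c)"
proof -
  let ?R = "radical_ring {j} d N" and ?E = "radical_basis {j} d N" and ?a = "radical d N j"
  let ?H = "int_span M T"
  define n where "n = N j"
  have n: "n > 0" using N_pos by (simp add: n_def)
  interpret based_radical_module "{j}" d N M B
    by (rule zplus_module_imp_based_radical_module[OF M])
  have jj: "j \<in> {j}" by simp
  have a: "?a \<in> carrier Rad" by (rule radical_in_ring) simp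
  have E: "?E \<subseteq> carrier Rad" by (rule radical_basis_subset) (use d_pos in auto)
  define y where "y m = (\<sigma> ^^ m) x" for m
  have y_pw: "y m \<in> B" "?a ^ m \<odot>\<^bsub>M\<^esub> x = add_pow M (int (\<Prod>i<m. w (y i))) (y m)" for m
    using power_smult[OF jj x act, of m] unfolding y_def by auto
  have y_Suc: "\<sigma> (y m) = y (Suc m)" for m by (simp add: y_def)
  have y_mod: "y (m mod n) = y m" for m
    unfolding y_def n_def by (rule funpow_mod_eq[OF period])
  have y_inj: "y m = y m' \<longleftrightarrow> m = m'" if "m < n" "m' < n" for m m'
    using inj that unfolding y_def n_def by (auto dest: inj_onD)
  have T_y: "T = y ` {..<n}" unfolding T y_def n_def by simp
  have TB: "T \<subseteq> B" using T_y y_pw by auto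
  have xT: "x \<in> T" using n unfolding T_y by (intro image_eqI[of _ _ 0]) (auto simp: y_def)
  have w_prod: "(\<Prod>m<n. w (y m)) = d j" using prod by (simp add: y_def n_def)
  have c_y: "c (Suc m) = w (y m)" if "m < n" for m
    using c that by (simp add: y_def n_def)
  have prod_c: "(\<Prod>k=1..n. c k) = d j"
  proof -
    have "(\<Prod>k=1..n. c k) = (\<Prod>m<n. c (Suc m))" by (simp add: prod.atLeast1_atMost_eq)
    also have "\<dots> = d j" using w_prod c_y by simp
    finally show ?thesis .
  qed
  have c_pos: "c k > 0" if "k \<in> {1..n}" for k
  proof (rule ccontr)
    assume "\<not> c k > 0"
    then have "(\<Prod>k=1..n. c k) = 0" using that by (intro prod_zero) auto
    then show False using prod_c d_pos by linarith
  qed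
  define g where "g = cyclic_generator n c"
  have g_pos: "g k > 0" for k
    unfolding g_def by (rule cyclic_generator_pos[OF n c_pos])
  have g_step: "?a * g (Suc m) = real (c (Suc m)) * g (Suc m mod n + 1)" if "m < n" for m
    using cyclic_generator_step[of n c "Suc m", OF n c_pos, unfolded prod_c] that
    by (simp add: g_def n_def)
  \<comment> \<open>Defined on all of \<open>M\<close>, with value \<open>0\<close> on basis elements outside the orbit, so that linearity can
    be checked on the basis of \<open>M\<close>.\<close>
  define h where "h z = (\<Sum>m<n. real_of_int (coord M B z (y m)) * g (Suc m))" for z
  have h_add: "additive_map M real_module h"
    by (auto simp: additive_map_def h_def M.coord_add y_pw sum.distrib[symmetric] algebra_simps)
  have h_y: "h (y m) = g (m mod n + 1)" for m
  proof -
    have mn: "m mod n < n" using n by simp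
    have "h (y m) = (\<Sum>i<n. if i = m mod n then g (Suc i) else 0)"
      unfolding h_def
    proof (rule sum.cong)
      fix i assume "i \<in> {..<n}"
      then show "real_of_int (coord M B (y m) (y i)) * g (Suc i) = (if i = m mod n then g (Suc i) else 0)"
        using y_inj[of i "m mod n"] mn y_mod[of m] y_pw by (simp add: M.coord_basis)
    qed simp
    then show ?thesis using mn by simp
  qed
  have h_out: "h b = 0" if "b \<in> B" "b \<notin> T" for b
    unfolding h_def using that y_pw
    by (intro sum.neutral) (auto simp: M.coord_basis T_y)
  interpret L: radical_module "{j}" d N real_module
    using module_real_module by (simp add: radical_module_def)
  have h_mult: "h (add_pow M (int k) z) = real k * h z" if "z \<in> carrier M" for k z
    using additive_map_mult[OF M.abelian_group_axioms L.M.abelian_group_axioms h_add that, of "int k"]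
      L.of_nat_smult[of "h z" k] by simp
  have h_lin: "h \<in> linear_maps Rad M real_module"
  proof (rule linear_mapsI[OF module_real_module h_add])
    fix i b assume "i \<in> {j}" and b: "b \<in> B"
    then have i: "i = j" by simp
    have ab: "h (?a \<odot>\<^bsub>M\<^esub> b) = real (w b) * h (\<sigma> b)"
      using act[OF b] h_mult by simp
    show "h (radical d N i \<odot>\<^bsub>M\<^esub> b) = radical d N i \<odot>\<^bsub>real_module\<^esub> h b"
    proof (cases "b \<in> T")
      case True
      then obtain m where m: "m < n" "b = y m" by (auto simp: T_y)
      have "h (?a \<odot>\<^bsub>M\<^esub> b) = real (c (Suc m)) * g (Suc m mod n + 1)"
        using ab m c_y[OF m(1)] y_Suc h_y[of "Suc m"] by simp
      also have "\<dots> = ?a * h b" using g_step[OF m(1)] h_y[of m] m by simp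
      finally show ?thesis by (simp add: i)
    next
      case False
      then have "\<sigma> b \<notin> T" using compl[OF b] by blast
      then show ?thesis using ab h_out act[OF b] b False by (simp add: i)
    qed
  qed
  \<comment> \<open>The \<open>m\<close>-th power of the radical maps \<open>x\<close> to the \<open>m\<close>-th point of the orbit times the first \<open>m\<close>
    weights; the remaining weights complete this product to \<open>d j\<close>.\<close>
  have multiple: "\<exists>u\<in>carrier Rad. add_pow M (int (d j)) z = u \<odot>\<^bsub>M\<^esub> x" if z: "z \<in> ?H" for z
  proof -
    have "T \<subseteq> carrier M" "finite T" using TB M.B_closed by (auto simp: T_y)
    then show ?thesis using z
    proof (rule M.span_induct)
      have "0 \<in> carrier Rad" using of_nat_radical_ring[of 0] by simp
      moreover have "0 \<odot>\<^bsub>M\<^esub> x = \<zero>\<^bsub>M\<^esub>" using M.smult_l_null[of x] x by simp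
      ultimately show "\<exists>u\<in>carrier Rad. add_pow M (int (d j)) \<zero>\<^bsub>M\<^esub> = u \<odot>\<^bsub>M\<^esub> x"
        by (intro bexI[of _ 0]) auto
    next
      fix z z' assume z: "z \<in> carrier M" "z' \<in> carrier M"
        and "\<exists>u\<in>carrier Rad. add_pow M (int (d j)) z = u \<odot>\<^bsub>M\<^esub> x"
        and "\<exists>u\<in>carrier Rad. add_pow M (int (d j)) z' = u \<odot>\<^bsub>M\<^esub> x"
      then obtain u u' where u: "u \<in> carrier Rad" "u' \<in> carrier Rad"
        "add_pow M (int (d j)) z = u \<odot>\<^bsub>M\<^esub> x" "add_pow M (int (d j)) z' = u' \<odot>\<^bsub>M\<^esub> x" by blast
      then show "\<exists>u\<in>carrier Rad. add_pow M (int (d j)) (z \<oplus>\<^bsub>M\<^esub> z') = u \<odot>\<^bsub>M\<^esub> x"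
        using z x by (intro bexI[of _ "u + u'"])
          (auto simp: M.int_mult_distrib add_smult intro: add_radical_ring)
    next
      fix k :: int and b assume "b \<in> T"
      then obtain m where m: "m < n" "b = y m" by (auto simp: T_y)
      define q where "q = (\<Prod>i\<in>{m..<n}. w (y i))"
      have "d j = q * (\<Prod>i<m. w (y i))"
        using prod.atLeastLessThan_concat[of 0 m n "\<lambda>i. w (y i)"] m(1) w_prod
        by (simp add: q_def mult.commute atLeast0LessThan)
      then have "add_pow M (int (d j)) (add_pow M k b) = add_pow M (k * int q) (?a ^ m \<odot>\<^bsub>M\<^esub> x)"
        using y_pw[of m] m by (simp add: M.int_mult_assoc mult.assoc mult.commute mult.left_commute)
      also have "\<dots> = real_of_int (k * int q) \<odot>\<^bsub>M\<^esub> (?a ^ m \<odot>\<^bsub>M\<^esub> x)"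
        by (rule of_int_smult[symmetric]) (use power_radical_ring[OF a] x in auto)
      also have "\<dots> = (real_of_int (k * int q) * ?a ^ m) \<odot>\<^bsub>M\<^esub> x"
        by (rule mult_smult[symmetric, OF of_int_radical_ring power_radical_ring[OF a]]) (use x in simp)
      finally show "\<exists>u\<in>carrier Rad. add_pow M (int (d j)) (add_pow M k b) = u \<odot>\<^bsub>M\<^esub> x"
        by (rule bexI) (intro mult_radical_ring of_int_radical_ring power_radical_ring a)
    qed
  qed
  have H_iff: "z \<in> ?H \<longleftrightarrow> z \<in> carrier M \<and> (\<forall>b\<in>B - T. coord M B z b = 0)" for z
    by (rule M.span_iff[OF TB])
  \<comment> \<open>The values of \<open>h\<close> are real numbers, so \<open>u * h x = 0\<close> with \<open>h x > 0\<close> forces \<open>u = 0\<close>.\<close>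
  have kernel: "z = \<zero>\<^bsub>M\<^esub>" if z: "z \<in> ?H" and hz: "h z = 0" for z
  proof -
    obtain u where u: "u \<in> carrier Rad" "add_pow M (int (d j)) z = u \<odot>\<^bsub>M\<^esub> x"
      using multiple[OF z] by blast
    have zM: "z \<in> carrier M" using z H_iff by blast
    have "u * h x = h (add_pow M (int (d j)) z)"
      using linear_maps_smult[OF h_lin u(1), of x] u(2) x by simp
    also have "\<dots> = 0" using h_mult[OF zM] hz by simp
    finally have "u * g 1 = 0" using h_y[of 0] by (simp add: y_def)
    then have "u = 0" using g_pos[of 1] by simp
    then have "add_pow M (int (d j)) z = \<zero>\<^bsub>M\<^esub>"
      using u(2) M.smult_l_null[of x] x by simp
    then show ?thesis using M.torsion_free[OF zM, of "int (d j)"] d_pos by simp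
  qed
  have h_inj: "inj_on h ?H"
  proof (rule inj_onI)
    fix z z' assume z: "z \<in> ?H" "z' \<in> ?H" and eq: "h z = h z'"
    have zM: "z \<in> carrier M" "z' \<in> carrier M" using z H_iff by blast+
    have diff: "z \<oplus>\<^bsub>M\<^esub> \<ominus>\<^bsub>M\<^esub> z' \<in> ?H"
      using z by (auto simp: H_iff M.coord_add M.coord_minus)
    have "h (\<ominus>\<^bsub>M\<^esub> z') + h z' = h (\<ominus>\<^bsub>M\<^esub> z' \<oplus>\<^bsub>M\<^esub> z')"
      using h_add zM by (simp add: additive_map_def)
    also have "\<dots> = 0"
      using zM additive_map_zero[OF M.abelian_group_axioms L.M.abelian_group_axioms h_add]
      by (simp add: M.l_neg)
    finally have "h (z \<oplus>\<^bsub>M\<^esub> \<ominus>\<^bsub>M\<^esub> z') = 0"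
      using h_add zM eq by (simp add: additive_map_def)
    then have "z \<oplus>\<^bsub>M\<^esub> \<ominus>\<^bsub>M\<^esub> z' = \<zero>\<^bsub>M\<^esub>" by (rule kernel[OF diff])
    then show "z = z'" using zM by (metis M.minus_equality M.minus_minus M.a_inv_closed)
  qed
  have TH: "T \<subseteq> ?H" using M.basis_in_span[OF TB] by blast
  have finT: "finite T" and TM: "T \<subseteq> carrier M" using TB M.B_closed by (auto simp: T_y)
  have hT: "h ` T = cyclic_basis n c"
  proof -
    have "h ` T = (\<lambda>m. g (Suc m)) ` {..<n}"
      unfolding T_y image_image using h_y by (intro image_cong) auto
    also have "\<dots> = g ` (Suc ` {..<n})" by (simp add: image_image)
    also have "Suc ` {..<n} = {1..n}" by (simp add: lessThan_atLeast0 image_Suc_atLeastLessThan atLeastLessThanSuc_atLeastAtMost)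
    finally show ?thesis by (simp add: cyclic_basis_def g_def)
  qed
  have h_lc: "h (lin_comb M T (\<lambda>b. q (h b))) = lin_comb real_module (cyclic_basis n c) q" for q
    using additive_map_lin_comb_inj[OF M.abelian_group_axioms L.M.abelian_group_axioms h_add finT TM
        inj_on_subset[OF h_inj TH], of q] hT by simp
  have h_img: "h ` ?H = int_span real_module (cyclic_basis n c)"
  proof safe
    fix z assume "z \<in> ?H"
    then obtain q where "z = lin_comb M T q" by (auto simp: int_span_iff_lin_comb)
    also have "\<dots> = lin_comb M T (\<lambda>b. q (inv_into T h (h b)))"
      using inj_on_subset[OF h_inj TH] TM by (intro M.lin_comb_cong) auto
    finally show "h z \<in> int_span real_module (cyclic_basis n c)"
      using h_lc[of "\<lambda>b. q (inv_into T h b)"] by (auto simp: int_span_iff_lin_comb)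
  next
    fix v assume "v \<in> int_span real_module (cyclic_basis n c)"
    then obtain q where "v = h (lin_comb M T (\<lambda>b. q (h b)))"
      using h_lc by (auto simp: int_span_iff_lin_comb)
    moreover have "lin_comb M T (\<lambda>b. q (h b)) \<in> ?H"
      unfolding int_span_iff_lin_comb by blast
    ultimately show "v \<in> h ` ?H" by (rule image_eqI)
  qed
  let ?S = "M\<lparr>carrier := ?H\<rparr>"
  have S: "zplus_module Rad ?E ?S T"
    by (rule zplus_module_span[OF M TB _ E sub]) (use xT in auto)
  have "h \<in> linear_maps Rad ?S (cyclic_module n c)"
    using h_lin h_img by (auto simp: linear_maps_def cyclic_module_def H_iff)
  moreover have "bij_betw h (carrier ?S) (carrier (cyclic_module n c))"
    using h_inj h_img by (simp add: bij_betw_def cyclic_module_def)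
  moreover have "h \<zero>\<^bsub>?S\<^esub> = \<zero>\<^bsub>cyclic_module n c\<^esub>"
    using additive_map_zero[OF M.abelian_group_axioms L.M.abelian_group_axioms h_add]
    by (simp add: cyclic_module_def)
  ultimately have "zplus_isomorphic Rad ?E ?S T (cyclic_module n c) (h ` T)"
    by (rule zplus_module_transfer[OF S E])
  then show ?thesis unfolding hT n_def .
qed


section \<open>Structure of irreducible modules\<close>

theorem theorem3p13:
  fixes r :: nat and d N :: "nat \<Rightarrow> nat"
    and M :: "(real, 'm) module" and B :: "'m set"
  assumes squarefree: "\<And>j. j \<in> {1..r} \<Longrightarrow> squarefree (d j)"
    and d_ge: "\<And>j. j \<in> {1..r} \<Longrightarrow> d j \<ge> 2"
    and coprime: "\<And>i j. i \<in> {1..r} \<Longrightarrow> j \<in> {1..r} \<Longrightarrow> i \<noteq> j \<Longrightarrow> coprime (d i) (d j)"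
    and N_ge: "\<And>j. j \<in> {1..r} \<Longrightarrow> N j \<ge> 2"
    and irreducible:
      "irreducible_zplus_module (radical_ring {1..r} d N) (radical_basis {1..r} d N) M B"
  shows "card B = (\<Prod>j = 1..r. N j) \<and>
    (\<forall>j\<in>{1..r}.
      let n = (\<Prod>k = 1..r. N k) div N j;
          S = radical_ring {j} d N;
          E = radical_basis {j} d N
      in \<exists>(Ms :: nat \<Rightarrow> (real, 'm) module) (Bs :: nat \<Rightarrow> 'm set).
           zplus_isomorphic S E M B (direct_sum {1..n} Ms) (direct_sum_basis {1..n} Ms Bs) \<and>
           (\<exists>c :: nat \<Rightarrow> nat.
              (\<forall>k\<in>{1..N j}. c k > 0 \<and> c k dvd d j) \<and>
              (\<Prod>k = 1..N j. c k) = d j \<and>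
              (\<forall>i\<in>{1..n}.
                 zplus_isomorphic S E (Ms i) (Bs i)
                   (cyclic_module (N j) c) (cyclic_basis (N j) c))))"
proof -
  interpret I: irreducible_radical_module r d N M B
    using assms by (rule irreducible_radical_module.intro)
  obtain s a where sa: "weighted_permutations r d N B s a"
    and act: "\<And>j b. j \<in> {1..r} \<Longrightarrow> b \<in> B \<Longrightarrow>
      radical d N j \<odot>\<^bsub>M\<^esub> b = add_pow M (int (a j b)) (s j b)"
    using I.ex_weighted_permutations by blast
  interpret W: weighted_permutations r d N B s a by (rule sa)
  obtain b0 where b0: "b0 \<in> B" using I.Z.basis_nonempty by blast
  show ?thesis
    unfolding Let_def
  proof (intro conjI ballI)
    show "card B = (\<Prod>j = 1..r. N j)" by (rule W.card_eq_prod[OF b0])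
  next
    fix j assume j: "j \<in> {1..r}"
    let ?n = "(\<Prod>k = 1..r. N k) div N j"
    let ?S = "radical_ring {j} d N" and ?E = "radical_basis {j} d N"
    have E: "?E \<subseteq> carrier ?S" by (rule radical_basis_subset) (use I.d_pos[OF j] in auto)
    have MS: "zplus_module ?S ?E M B"
      by (rule restrict_scalars_zplus[OF I.zplus]) (use j I.d_pos I.N_pos in auto)
    interpret Y: based_radical_module "{j}" d N M B
      by (rule zplus_module_imp_based_radical_module[OF MS])
    obtain f where f: "f ` {1..?n} \<subseteq> B" "(\<Union>i\<in>{1..?n}. W.orbit j (f i)) = B"
      and disj: "\<And>i i'. i \<in> {1..?n} \<Longrightarrow> i' \<in> {1..?n} \<Longrightarrow> i \<noteq> i' \<Longrightarrow>
        W.orbit j (f i) \<inter> W.orbit j (f i') = {}"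
      and prof: "\<And>i k. i \<in> {1..?n} \<Longrightarrow> a j ((s j ^^ k) (f i)) = a j ((s j ^^ k) b0)"
      by (rule W.orbit_decomposition[OF j b0]) (rule that)
    have fB: "f i \<in> B" if "i \<in> {1..?n}" for i using f(1) that by blast
    define T where "T i = W.orbit j (f i)" for i
    define Ms where "Ms i = M\<lparr>carrier := int_span M (T i)\<rparr>" for i
    define c where "c k = a j ((s j ^^ (k - 1)) b0)" for k
    have sub: "submodule (int_span M (T i)) ?S M" if i: "i \<in> {1..?n}" for i
    proof (rule Y.submodule_spanI)
      show TB: "T i \<subseteq> B" unfolding T_def by (rule W.orbit_subset[OF j fB[OF i]])
      fix j' b assume "j' \<in> {j}" and b: "b \<in> T i"
      then have j': "j' = j" by simp
      have "s j b \<in> T i" using b W.s_mem_orbit_iff[OF j fB[OF i]] TB unfolding T_def by blast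
      then show "radical d N j' \<odot>\<^bsub>M\<^esub> b \<in> int_span M (T i)"
        using act[OF j] b TB I.M.mult_basis_in_span[OF TB] by (auto simp: j')
    qed
    have sum: "zplus_isomorphic ?S ?E M B (direct_sum {1..?n} Ms) (direct_sum_basis {1..?n} Ms T)"
      unfolding Ms_def
      by (rule direct_sum_decomposition[OF MS E]) (use f(2) disj sub in \<open>auto simp: T_def\<close>)
    have prod_c: "(\<Prod>k = 1..N j. c k) = d j"
    proof -
      have "(\<Prod>k = 1..N j. c k) = (\<Prod>m<N j. c (Suc m))" by (simp add: prod.atLeast1_atMost_eq)
      also have "\<dots> = d j" using W.a_prod[OF j b0] by (simp add: c_def)
      finally show ?thesis .
    qed
    have c: "c k > 0 \<and> c k dvd d j" if "k \<in> {1..N j}" for k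
    proof -
      have "c k dvd (\<Prod>k = 1..N j. c k)" by (rule dvd_prodI) (use that in auto)
      then show ?thesis using prod_c I.d_pos[OF j] by (auto intro: dvd_pos_nat)
    qed
    have "zplus_isomorphic ?S ?E (Ms i) (T i) (cyclic_module (N j) c) (cyclic_basis (N j) c)"
      if i: "i \<in> {1..?n}" for i
      unfolding Ms_def
    proof (rule zplus_module_cyclic_iso[OF MS I.d_pos[OF j] I.N_pos[OF j]])
      show "s j b \<in> B \<and> radical d N j \<odot>\<^bsub>M\<^esub> b = add_pow M (int (a j b)) (s j b)" if "b \<in> B" for b
        using act[OF j that] W.s_closed[OF j that] by blast
      show "c (Suc m) = a j ((s j ^^ m) (f i))" for m
        using prof[OF i] by (simp add: c_def)
      show "T i = (\<lambda>m. (s j ^^ m) (f i)) ` {..<N j}" by (simp add: T_def W.orbit_def)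
      show "b \<in> T i" if "b \<in> B" "s j b \<in> T i" for b
        using W.s_mem_orbit_iff[OF j fB[OF i] that(1)] that(2) by (simp add: T_def)
    qed (use sub[OF i] W.s_period[OF j fB[OF i]] W.inj_on_orbit[OF j fB[OF i]] fB[OF i]
        W.a_prod[OF j fB[OF i]] in simp_all)
    then show "\<exists>(Ms :: nat \<Rightarrow> (real, 'm) module) (Bs :: nat \<Rightarrow> 'm set).
           zplus_isomorphic ?S ?E M B (direct_sum {1..?n} Ms) (direct_sum_basis {1..?n} Ms Bs) \<and>
           (\<exists>c :: nat \<Rightarrow> nat.
              (\<forall>k\<in>{1..N j}. c k > 0 \<and> c k dvd d j) \<and>
              (\<Prod>k = 1..N j. c k) = d j \<and>
              (\<forall>i\<in>{1..?n}.
                 zplus_isomorphic ?S ?E (Ms i) (Bs i)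
                   (cyclic_module (N j) c) (cyclic_basis (N j) c)))"
      using sum c prod_c by metis
  qed
qed

end
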